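(* There exists an infinite connected weighted graph $\Gamma$ which satisfies (LB), (D$_\beta$) and (UE$_\beta$) for some bounded function $\beta\ge 1$ on $\Gamma\times\Gamma$, but which, for every constant $m\ge2$, does not satisfy the combination of (D$_2$) and (UE$_m$).
   Context: A weighted graph is an infinite set $\Gamma$ with a symmetric weight $\mu_{xy}=\mu_{yx}\ge0$; $x\sim y$ iff $\mu_{xy}>0$ (loops $x\sim x$ allowed); it is assumed that $\sup_x\#\{y:y\sim x\}<\infty$. Measure: $m(x)=\sum_{y\sim x}\mu_{xy}$, $m(E)=\sum_{x\in E}m(x)$ (not to be confused with the exponent $m$). Kernel: $p(x,y)=\frac{\mu_{xy}}{m(x)m(y)}$, $p_0(x,y)=\frac{1_{x=y}}{m(y)}$, $p_{k+1}(x,y)=\sum_z p(x,z)p_k(z,y)m(z)$. $\delta$ is the graph distance (length of a shortest path), $V_\delta(x,r)=m(\{y:\delta(x,y)<r\})$. (LB): there is $\epsilon>0$ with $p(x,x)m(x)>\epsilon$ for all $x$. For a function $\beta:\Gamma\times\Gamma\to[1,B]$, $B<\infty$, put $\rho(x,y)=\delta(x,y)^{\beta(x,y)}$ and $V_\rho(x,r)=m(\{y:\rho(x,y)<r\})$. (D$_\beta$): there is $C$ with $V_\rho(x,2r)\le CV_\rho(x,r)$ for all $x\in\Gamma$, $r>0$. (UE$_\beta$): for every $N\in\mathbb N$ there is $C_N$ with $p_{k-1}(x,y)\le\frac{C_N}{V_\rho(x,k)}\left(1+\frac{\rho(x,y)}k\right)^{-N}$ for all $x,y\in\Gamma$, $k\ge1$.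 (D$_2$): there is $C$ with $V_\delta(x,2r)\le CV_\delta(x,r)$ for all $x\in\Gamma$, $r\in\mathbb N$. (UE$_m$) for a constant $m>2$: there are $C,c>0$ with $p_{k-1}(x,y)\le\frac{C}{V_\delta(x,k^{1/m})}\exp\left(-c\left[\frac{\delta(x,y)^m}{k}\right]^{1/(m-1)}\right)$ for all $x,y\in\Gamma$, $k\ge1$. (UE$_m$) for $m=2$: there are $C,c>0$ with $p_k(x,y)\le\frac{C}{V_\delta(x,\sqrt k)}\exp\left(-c\frac{\delta(x,y)^2}{k}\right)$ for all $x,y\in\Gamma$, $k\ge1$. *)

theory Defs
  imports "HOL-Analysis.Analysis"
begin

text \<open>
  A weighted graph is given by a vertex set \<open>\<Gamma>\<close> and a weight \<open>\<mu>\<close>; only the values of \<open>\<mu>\<close> on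
  \<open>\<Gamma> \<times> \<Gamma>\<close> matter.
\<close>

definition adj :: "'a set \<Rightarrow> ('a \<Rightarrow> 'a \<Rightarrow> real) \<Rightarrow> 'a \<Rightarrow> 'a \<Rightarrow> bool" where
  "adj \<Gamma> \<mu> x y \<longleftrightarrow> x \<in> \<Gamma> \<and> y \<in> \<Gamma> \<and> \<mu> x y > 0"

definition weighted_graph :: "'a set \<Rightarrow> ('a \<Rightarrow> 'a \<Rightarrow> real) \<Rightarrow> bool" where
  "weighted_graph \<Gamma> \<mu> \<longleftrightarrow>
     infinite \<Gamma> \<and>
     (\<forall>x\<in>\<Gamma>. \<forall>y\<in>\<Gamma>. \<mu> x y = \<mu> y x \<and> \<mu> x y \<ge> 0) \<and>
     (\<exists>M::nat. \<forall>x\<in>\<Gamma>. finite {y. adj \<Gamma> \<mu> x y} \<and> card {y. adj \<Gamma> \<mu> x y} \<le> M)"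

definition connected_graph :: "'a set \<Rightarrow> ('a \<Rightarrow> 'a \<Rightarrow> real) \<Rightarrow> bool" where
  "connected_graph \<Gamma> \<mu> \<longleftrightarrow> (\<forall>x\<in>\<Gamma>. \<forall>y\<in>\<Gamma>. (adj \<Gamma> \<mu>)\<^sup>*\<^sup>* x y)"

definition vmeas :: "'a set \<Rightarrow> ('a \<Rightarrow> 'a \<Rightarrow> real) \<Rightarrow> 'a \<Rightarrow> real" where
  "vmeas \<Gamma> \<mu> x = (\<Sum>y | adj \<Gamma> \<mu> x y. \<mu> x y)"

text \<open>
  The measure of a set of vertices, as a real number. It is only used for finite sets: in a
  connected weighted graph the balls for \<open>gdist\<close> are finite by the bound on the degrees, and the
  balls for \<open>rho\<close> are contained in balls for \<open>gdist\<close> whenever \<open>\<beta> \<ge> 1\<close>.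
\<close>

definition smeas :: "'a set \<Rightarrow> ('a \<Rightarrow> 'a \<Rightarrow> real) \<Rightarrow> 'a set \<Rightarrow> real" where
  "smeas \<Gamma> \<mu> E = (\<Sum>x\<in>E. vmeas \<Gamma> \<mu> x)"

definition kernel :: "'a set \<Rightarrow> ('a \<Rightarrow> 'a \<Rightarrow> real) \<Rightarrow> 'a \<Rightarrow> 'a \<Rightarrow> real" where
  "kernel \<Gamma> \<mu> x y = \<mu> x y / (vmeas \<Gamma> \<mu> x * vmeas \<Gamma> \<mu> y)"

text \<open>
  The infinite sum has finite support, since \<open>kernel \<Gamma> \<mu> x z\<close> vanishes unless \<open>z\<close> is a
  neighbour of \<open>x\<close>.
\<close>

primrec kernel_iter :: "'a set \<Rightarrow> ('a \<Rightarrow> 'a \<Rightarrow> real) \<Rightarrow> nat \<Rightarrow> 'a \<Rightarrow> 'a \<Rightarrow> real" where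
  "kernel_iter \<Gamma> \<mu> 0 = (\<lambda>x y. (if x = y then 1 else 0) / vmeas \<Gamma> \<mu> y)"
| "kernel_iter \<Gamma> \<mu> (Suc k) =
     (\<lambda>x y. \<Sum>\<^sub>\<infinity>z\<in>\<Gamma>. kernel \<Gamma> \<mu> x z * kernel_iter \<Gamma> \<mu> k z y * vmeas \<Gamma> \<mu> z)"

text \<open>
  The relational power \<open>(adj \<Gamma> \<mu> ^^ n) x y\<close> says that a path with \<open>n\<close> edges joins \<open>x\<close> to \<open>y\<close>;
  \<open>gdist\<close> is meaningful for vertices of a connected graph.
\<close>

definition gdist :: "'a set \<Rightarrow> ('a \<Rightarrow> 'a \<Rightarrow> real) \<Rightarrow> 'a \<Rightarrow> 'a \<Rightarrow> nat" where
  "gdist \<Gamma> \<mu> x y = (LEAST n. (adj \<Gamma> \<mu> ^^ n) x y)"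

definition V_delta :: "'a set \<Rightarrow> ('a \<Rightarrow> 'a \<Rightarrow> real) \<Rightarrow> 'a \<Rightarrow> real \<Rightarrow> real" where
  "V_delta \<Gamma> \<mu> x r = smeas \<Gamma> \<mu> {y \<in> \<Gamma>. real (gdist \<Gamma> \<mu> x y) < r}"

definition rho :: "'a set \<Rightarrow> ('a \<Rightarrow> 'a \<Rightarrow> real) \<Rightarrow> ('a \<Rightarrow> 'a \<Rightarrow> real) \<Rightarrow> 'a \<Rightarrow> 'a \<Rightarrow> real" where
  "rho \<Gamma> \<mu> \<beta> x y = real (gdist \<Gamma> \<mu> x y) powr \<beta> x y"

definition V_rho ::
    "'a set \<Rightarrow> ('a \<Rightarrow> 'a \<Rightarrow> real) \<Rightarrow> ('a \<Rightarrow> 'a \<Rightarrow> real) \<Rightarrow> 'a \<Rightarrow> real \<Rightarrow> real" where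
  "V_rho \<Gamma> \<mu> \<beta> x r = smeas \<Gamma> \<mu> {y \<in> \<Gamma>. rho \<Gamma> \<mu> \<beta> x y < r}"

definition LB :: "'a set \<Rightarrow> ('a \<Rightarrow> 'a \<Rightarrow> real) \<Rightarrow> bool" where
  "LB \<Gamma> \<mu> \<longleftrightarrow> (\<exists>\<epsilon>>0. \<forall>x\<in>\<Gamma>. kernel \<Gamma> \<mu> x x * vmeas \<Gamma> \<mu> x > \<epsilon>)"

definition D_beta :: "'a set \<Rightarrow> ('a \<Rightarrow> 'a \<Rightarrow> real) \<Rightarrow> ('a \<Rightarrow> 'a \<Rightarrow> real) \<Rightarrow> bool" where
  "D_beta \<Gamma> \<mu> \<beta> \<longleftrightarrow>
     (\<exists>C::real. \<forall>x\<in>\<Gamma>. \<forall>r>0. V_rho \<Gamma> \<mu> \<beta> x (2 * r) \<le> C * V_rho \<Gamma> \<mu> \<beta> x r)"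

definition UE_beta :: "'a set \<Rightarrow> ('a \<Rightarrow> 'a \<Rightarrow> real) \<Rightarrow> ('a \<Rightarrow> 'a \<Rightarrow> real) \<Rightarrow> bool" where
  "UE_beta \<Gamma> \<mu> \<beta> \<longleftrightarrow>
     (\<forall>N::nat. \<exists>C::real. \<forall>x\<in>\<Gamma>. \<forall>y\<in>\<Gamma>. \<forall>k\<ge>1.
        kernel_iter \<Gamma> \<mu> (k - 1) x y
          \<le> C / V_rho \<Gamma> \<mu> \<beta> x (real k) * (1 + rho \<Gamma> \<mu> \<beta> x y / real k) powr (- real N))"

definition D_2 :: "'a set \<Rightarrow> ('a \<Rightarrow> 'a \<Rightarrow> real) \<Rightarrow> bool" where
  "D_2 \<Gamma> \<mu> \<longleftrightarrow>
     (\<exists>C::real. \<forall>x\<in>\<Gamma>. \<forall>r::nat. V_delta \<Gamma> \<mu> x (2 * real r) \<le> C * V_delta \<Gamma> \<mu> x (real r))"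

text \<open>
  For the constant exponent \<open>m = 2\<close> the estimate bounds \<open>p\<^sub>k\<close>, for \<open>m > 2\<close> it bounds \<open>p\<^bsub>k-1\<^esub>\<close>.
\<close>

definition UE :: "'a set \<Rightarrow> ('a \<Rightarrow> 'a \<Rightarrow> real) \<Rightarrow> real \<Rightarrow> bool" where
  "UE \<Gamma> \<mu> m \<longleftrightarrow>
     (if m = 2 then
        (\<exists>C>0. \<exists>c>0. \<forall>x\<in>\<Gamma>. \<forall>y\<in>\<Gamma>. \<forall>k\<ge>1.
           kernel_iter \<Gamma> \<mu> k x y
             \<le> C / V_delta \<Gamma> \<mu> x (sqrt (real k)) *
               exp (- c * ((real (gdist \<Gamma> \<mu> x y))\<^sup>2 / real k)))
      else
        (\<exists>C>0. \<exists>c>0. \<forall>x\<in>\<Gamma>. \<forall>y\<in>\<Gamma>. \<forall>k\<ge>1.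
           kernel_iter \<Gamma> \<mu> (k - 1) x y
             \<le> C / V_delta \<Gamma> \<mu> x (real k powr (1 / m)) *
               exp (- c * (real (gdist \<Gamma> \<mu> x y) powr m / real k) powr (1 / (m - 1)))))"

end

theory Submission
  imports Defs
begin

text \<open>
  The condition (D\<open>\<^sub>2\<close>) speaks of the graph distance \<open>\<delta>\<close> alone, while (D\<open>\<^sub>\<beta>\<close>) and
  (UE\<open>\<^sub>\<beta>\<close>) speak of \<open>\<rho> = \<delta>\<^bsup>\<beta>\<^esup>\<close>. A variable exponent can repair a badly behaved \<open>\<delta>\<close>: it
  suffices that the random walk is diffusive for some other metric that \<open>\<delta>\<close> distorts polynomially.
  The graph constructed here fails (D\<open>\<^sub>2\<close>), so it fails the combination of (D\<open>\<^sub>2\<close>) and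
  (UE\<open>\<^sub>m\<close>) for every \<open>m\<close> at once.

  The vertices are the natural numbers, the edges between successive integers have weights of order 1,
  and every vertex has a heavy loop. The half-line is cut into consecutive intervals, the cells, and
  an edge whose weight is exponentially small in the length of the cell, the chord, joins the two ends
  of each cell. The chords turn the half-line into a necklace of cycles. Long chords shorten \<open>\<delta>\<close>
  drastically, but the walk hardly ever uses them.

  \<^item> \<^emph>\<open>The walk remains diffusive for\<close> \<open>\<bar>x - y\<bar>\<close>. The weights are balanced so that the
  position is harmonic away from the left end point, which gives exponential moments of the
  displacement at the scale \<open>\<surd>n\<close>. The edges between successive integers alone give a
  one-dimensional Nash inequality, hence a return probability of order \<open>1/\<surd>n\<close>. Together:
  \<open>p\<^sub>n(x,y) \<le> C n\<^bsup>-1/2\<^esup> exp (- \<bar>x - y\<bar> / (2\<surd>n))\<close>, with \<open>n + 1\<close> in place of \<open>n\<close>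
  (lemma \<open>heat_kernel_bound\<close>).

  \<^item> \<^emph>\<open>Balls for\<close> \<open>\<delta>\<close> \<^emph>\<open>grow at most quadratically.\<close> A ball of radius \<open>s\<close> meets at most
  \<open>2s + 1\<close> cells, each of them in at most \<open>4s + 2\<close> points because the distance to the nearer end
  of the cell changes by at most one along an edge. The bound is uniform in the lengths of the cells
  (lemma \<open>card_ball\<close>).

  \<^item> \<^emph>\<open>The choice of\<close> \<open>\<beta>\<close>. It is made so that \<open>\<rho>(x,y) = min \<delta>(x,y)\<^sup>4 \<bar>x - y\<bar>\<^sup>2\<close>. Both
  competitors have balls of size \<open>O(\<surd>r + 1)\<close>, and the second one has balls of at least this
  order. Thus \<open>V\<^sub>\<rho>(x,r)\<close> is comparable with \<open>\<surd>r + 1\<close>, which gives (D\<open>\<^sub>\<beta>\<close>), and the heat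
  kernel bound gives (UE\<open>\<^sub>\<beta>\<close>) because \<open>\<rho> \<le> \<bar>x - y\<bar>\<^sup>2\<close>.

  \<^item> \<^emph>\<open>Doubling fails for\<close> \<open>\<delta>\<close>. The lengths of the cells are still free. If a run of cells of
  length 1 is followed by a run of long cells, then a ball centred in the first run grows linearly
  until it reaches the second one, where it starts to grow quadratically. Runs of unbounded
  lengths make the ratio of the volumes at comparable radii unbounded.
\<close>

section \<open>Random walks with a symmetric transition matrix\<close>

locale symmetric_walk =
  fixes P :: "'a \<Rightarrow> 'a \<Rightarrow> real"
  assumes P_nonneg: "0 \<le> P x y"
    and P_sym: "P x y = P y x"
    and finite_support: "finite {y. P x y \<noteq> 0}"
    and P_sum: "(\<Sum>y | P x y \<noteq> 0. P x y) = 1"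
begin

definition nb :: "'a \<Rightarrow> 'a set" where
  "nb x = {y. P x y \<noteq> 0}"

definition avg :: "('a \<Rightarrow> real) \<Rightarrow> 'a \<Rightarrow> real" where
  "avg f x = (\<Sum>y\<in>nb x. P x y * f y)"

primrec p :: "nat \<Rightarrow> 'a \<Rightarrow> 'a \<Rightarrow> real" where
  "p 0 = (\<lambda>x y. if x = y then 1 else 0)"
| "p (Suc n) = (\<lambda>x y. avg (\<lambda>z. p n z y) x)"

text \<open>
  Finite sets that carry the rows of the iterated matrix, so that all sums below are finite.
\<close>

primrec reach :: "nat \<Rightarrow> 'a \<Rightarrow> 'a set" where
  "reach 0 = (\<lambda>x. {x})"
| "reach (Suc n) = (\<lambda>x. \<Union>z\<in>nb x. reach n z)"

lemma finite_nb [simp]: "finite (nb x)"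
  using finite_support by (simp add: nb_def)

lemma sum_nb: "(\<Sum>y\<in>nb x. P x y) = 1"
  using P_sum by (simp add: nb_def)

lemma P_outside: "y \<notin> nb x \<Longrightarrow> P x y = 0"
  by (simp add: nb_def)

lemma finite_reach [simp]: "finite (reach n x)"
  by (induction n arbitrary: x) auto

lemma p_nonneg: "0 \<le> p n x y"
  by (induction n arbitrary: x) (auto simp: avg_def P_nonneg intro!: sum_nonneg)

lemma p_outside: "z \<notin> reach n x \<Longrightarrow> p n x z = 0"
  by (induction n arbitrary: x) (auto simp: avg_def)

lemma avg_mono: "(\<And>y. f y \<le> g y) \<Longrightarrow> avg f x \<le> avg g x"
  unfolding avg_def by (intro sum_mono mult_left_mono P_nonneg)

lemma avg_cmult: "avg (\<lambda>y. c * f y) x = c * avg f x"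
  unfolding avg_def by (simp add: sum_distrib_left mult_ac)

lemma avg_add: "avg (\<lambda>y. f y + g y) x = avg f x + avg g x"
  unfolding avg_def by (simp add: sum.distrib algebra_simps)

lemma avg_one: "avg (\<lambda>_. 1) = (\<lambda>_. 1)"
  by (rule ext) (simp add: avg_def sum_nb)

lemma avg_eq_sum: "finite S \<Longrightarrow> nb x \<subseteq> S \<Longrightarrow> avg f x = (\<Sum>y\<in>S. P x y * f y)"
  unfolding avg_def by (rule sum.mono_neutral_left) (auto simp: P_outside)

lemma avg_pow_eq_sum: "(avg ^^ n) f x = (\<Sum>z\<in>reach n x. p n x z * f z)"
proof (induction n arbitrary: x)
  case 0
  then show ?case by simp
next
  case (Suc n)
  let ?R = "reach (Suc n) x"
  have "(avg ^^ Suc n) f x = (\<Sum>z\<in>nb x. P x z * (\<Sum>w\<in>reach n z. p n z w * f w))"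
    unfolding funpow.simps comp_apply avg_def[of "(avg ^^ n) f"] by (simp only: Suc.IH)
  also have "\<dots> = (\<Sum>z\<in>nb x. P x z * (\<Sum>w\<in>?R. p n z w * f w))"
    by (intro sum.cong refl arg_cong2[where f = "(*)"] sum.mono_neutral_left)
       (auto simp: p_outside)
  also have "\<dots> = (\<Sum>z\<in>nb x. \<Sum>w\<in>?R. P x z * p n z w * f w)"
    by (simp only: sum_distrib_left mult.assoc)
  also have "\<dots> = (\<Sum>w\<in>?R. \<Sum>z\<in>nb x. P x z * p n z w * f w)"
    by (rule sum.swap)
  also have "\<dots> = (\<Sum>w\<in>?R. p (Suc n) x w * f w)"
    by (simp only: p.simps avg_def sum_distrib_right)
  finally show ?case .
qed

lemma p_add: "p (m + n) x y = (\<Sum>z\<in>reach m x. p m x z * p n z y)"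
proof -
  have "(\<lambda>x. p (m + n) x y) = (avg ^^ m) (\<lambda>z. p n z y)" by (induction m) simp_all
  then show ?thesis using avg_pow_eq_sum[of m "\<lambda>z. p n z y" x] by metis
qed

lemma p_sum: "(\<Sum>z\<in>reach n x. p n x z) = 1"
proof -
  have "(avg ^^ n) (\<lambda>_. 1) = (\<lambda>_. 1)" by (induction n) (simp_all add: avg_one)
  then show ?thesis using avg_pow_eq_sum[of n "\<lambda>_. 1" x] by simp
qed

lemma p_one: "p (Suc 0) x y = P x y"
  by (auto simp: avg_def if_distrib P_outside cong: if_cong)

lemma p_sym: "p n x y = p n y x"
proof (induction n arbitrary: x y)
  case 0
  then show ?case by simp
next
  case (Suc n)
  have "p (Suc n) x y = (\<Sum>z\<in>nb x. P x z * p n y z)"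
    using Suc.IH by (simp add: avg_def)
  also have "\<dots> = (\<Sum>z\<in>nb x \<union> reach n y. P x z * p n y z)"
    by (rule sum.mono_neutral_left) (auto simp: P_outside)
  also have "\<dots> = (\<Sum>z\<in>reach n y. P x z * p n y z)"
    by (rule sum.mono_neutral_right) (auto simp: p_outside)
  also have "\<dots> = (\<Sum>z\<in>reach n y. p n y z * p (Suc 0) z x)"
    by (simp only: p_one P_sym[of x] mult.commute)
  also have "\<dots> = p (n + Suc 0) y x" by (rule p_add[symmetric])
  finally show ?case by simp
qed

lemma p_double: "p (n + n) x y = (\<Sum>z\<in>reach n x. p n x z * p n y z)"
  unfolding p_add by (simp only: p_sym[of n y])

text \<open>
  The counting measure is invariant under a symmetric stochastic matrix; only the mass that stays
  inside the finite set is counted, hence an inequality.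
\<close>

lemma sum_avg_le:
  assumes "finite S" "\<And>y. y \<notin> S \<Longrightarrow> f y = 0" "\<And>y. 0 \<le> f y"
  shows "(\<Sum>x\<in>S. avg f x) \<le> (\<Sum>x\<in>S. f x)"
proof -
  have "avg f x = (\<Sum>y\<in>S. P x y * f y)" for x
  proof -
    have "avg f x = (\<Sum>y\<in>nb x \<union> S. P x y * f y)" using assms(1) by (intro avg_eq_sum) auto
    also have "\<dots> = (\<Sum>y\<in>S. P x y * f y)"
      using assms by (intro sum.mono_neutral_right) auto
    finally show ?thesis .
  qed
  then have "(\<Sum>x\<in>S. avg f x) = (\<Sum>y\<in>S. \<Sum>x\<in>S. P x y * f y)"
    by (simp add: sum.swap[of "\<lambda>x y. P x y * f y"])
  also have "\<dots> = (\<Sum>y\<in>S. f y * (\<Sum>x\<in>S. P y x))"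
    by (simp add: sum_distrib_left P_sym mult.commute)
  also have "\<dots> \<le> (\<Sum>y\<in>S. f y * 1)"
  proof (intro sum_mono mult_left_mono assms)
    fix y
    have "(\<Sum>x\<in>S. P y x) \<le> (\<Sum>x\<in>S \<union> nb y. P y x)"
      using assms(1) by (intro sum_mono2) (auto simp: P_nonneg)
    also have "\<dots> = (\<Sum>x\<in>nb y. P y x)"
      using assms(1) by (intro sum.mono_neutral_right) (auto simp: P_outside)
    finally show "(\<Sum>x\<in>S. P y x) \<le> 1" by (simp add: sum_nb)
  qed
  finally show ?thesis by simp
qed

text \<open>
  The difference of the two sides without the second summand is the variance of \<open>f\<close> after one
  step from \<open>x\<close>, and two points of masses \<open>p\<close> and \<open>q\<close> with values \<open>u\<close> and \<open>v\<close> already contribute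
  at least \<open>pq (u - v)\<^sup>2\<close>. Applied to a point and its successor, this controls the decay of the
  \<open>\<ell>\<^sup>2\<close> norm in one step without passing to the square of the matrix.
\<close>

lemma variance_lower_bound:
  assumes "a \<noteq> b"
  shows "(avg f x)\<^sup>2 + P x a * P x b * (f a - f b)\<^sup>2 \<le> avg (\<lambda>y. (f y)\<^sup>2) x"
proof -
  let ?c = "avg f x" and ?S = "nb x \<union> {a, b}"
  have avgS: "avg g x = (\<Sum>y\<in>?S. P x y * g y)" for g by (intro avg_eq_sum) auto
  have one: "(\<Sum>y\<in>?S. P x y) = 1"
    using avgS[of "\<lambda>_. 1"] by (simp add: avg_one)
  have c: "(\<Sum>y\<in>?S. P x y * f y) = ?c" by (simp only: avgS[symmetric])
  have "(\<Sum>y\<in>?S. P x y * (f y - ?c)\<^sup>2)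
      = (\<Sum>y\<in>?S. P x y * (f y)\<^sup>2 - 2 * ?c * (P x y * f y) + ?c\<^sup>2 * P x y)"
    by (intro sum.cong refl) (simp add: power2_eq_square algebra_simps)
  also have "\<dots> = avg (\<lambda>y. (f y)\<^sup>2) x - 2 * ?c * ?c + ?c\<^sup>2"
    unfolding sum.distrib sum_subtractf sum_distrib_left[symmetric] one c avgS[symmetric] by simp
  finally have var: "(\<Sum>y\<in>?S. P x y * (f y - ?c)\<^sup>2) = avg (\<lambda>y. (f y)\<^sup>2) x - ?c\<^sup>2"
    by (simp add: power2_eq_square)
  have "(\<Sum>y\<in>{a, b}. P x y * (f y - ?c)\<^sup>2) \<le> (\<Sum>y\<in>?S. P x y * (f y - ?c)\<^sup>2)"
    by (intro sum_mono2) (auto simp: P_nonneg)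
  then have 1: "P x a * (f a - ?c)\<^sup>2 + P x b * (f b - ?c)\<^sup>2 \<le> avg (\<lambda>y. (f y)\<^sup>2) x - ?c\<^sup>2"
    using assms var by simp
  have "(\<Sum>y\<in>{a, b}. P x y) \<le> (\<Sum>y\<in>?S. P x y)"
    by (intro sum_mono2) (auto simp: P_nonneg)
  then have ab: "P x a + P x b \<le> 1" using assms one by simp
  define A B u v where "A = P x a" and "B = P x b" and "u = f a - ?c" and "v = f b - ?c"
  have nn: "0 \<le> A" "0 \<le> B" and AB: "A + B \<le> 1" using ab by (auto simp: A_def B_def P_nonneg)
  \<comment> \<open>The deficit is a sum of nonnegative terms because \<open>A + B \<le> 1\<close>.\<close>
  have "A * u\<^sup>2 + B * v\<^sup>2 - A * B * (u - v)\<^sup>2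
      = A * (1 - A - B) * u\<^sup>2 + B * (1 - A - B) * v\<^sup>2 + (A * u + B * v)\<^sup>2"
    by (simp add: power2_eq_square algebra_simps)
  also have "\<dots> \<ge> 0" using nn AB by simp
  finally have "A * B * (u - v)\<^sup>2 \<le> A * u\<^sup>2 + B * v\<^sup>2" by simp
  moreover have "u - v = f a - f b" by (simp add: u_def v_def)
  ultimately show ?thesis using 1 by (simp add: A_def B_def u_def v_def)
qed

end

section \<open>The Nash inequality and on-diagonal decay\<close>

text \<open>
  Telescoping \<open>f(n)\<^sup>2\<close> to the right and the Cauchy-Schwarz inequality bound the maximum of \<open>f\<close> by
  the energy and the \<open>\<ell>\<^sup>2\<close> norm; interpolation of the \<open>\<ell>\<^sup>2\<close> norm between the \<open>\<ell>\<^sup>1\<close> norm and the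
  maximum then removes the maximum.
\<close>

lemma nash_half_line:
  fixes f :: "nat \<Rightarrow> real"
  assumes nonneg: "\<And>n. 0 \<le> f n" and vanish: "\<And>n. N < n \<Longrightarrow> f n = 0"
    and mass: "(\<Sum>n\<le>N. f n) \<le> 1"
  shows "(\<Sum>n\<le>N. (f n)\<^sup>2) ^ 3 \<le> 4 * (\<Sum>n\<le>N. (f n - f (Suc n))\<^sup>2)"
proof -
  define U where "U = (\<Sum>n\<le>N. (f n)\<^sup>2)"
  define G where "G = (\<Sum>n\<le>N. (f n - f (Suc n))\<^sup>2)"
  have U0: "0 \<le> U" and G0: "0 \<le> G" by (auto simp: U_def G_def intro: sum_nonneg)
  have shift: "(\<Sum>n\<le>N. (f (Suc n))\<^sup>2) \<le> U"
  proof -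
    have "(\<Sum>n\<le>N. (f (Suc n))\<^sup>2) = (\<Sum>n\<le>Suc N. (f n)\<^sup>2) - (f 0)\<^sup>2"
      by (subst sum.atMost_Suc_shift) simp
    then show ?thesis by (simp add: U_def vanish)
  qed
  have sq: "(\<Sum>n\<le>N. (f n + f (Suc n))\<^sup>2) \<le> 4 * U"
  proof -
    have "(\<Sum>n\<le>N. (f n + f (Suc n))\<^sup>2) \<le> (\<Sum>n\<le>N. 2 * (f n)\<^sup>2 + 2 * (f (Suc n))\<^sup>2)"
    proof (intro sum_mono)
      fix n
      have "0 \<le> (f n - f (Suc n))\<^sup>2" by simp
      then show "(f n + f (Suc n))\<^sup>2 \<le> 2 * (f n)\<^sup>2 + 2 * (f (Suc n))\<^sup>2"
        by (simp add: power2_eq_square algebra_simps)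
    qed
    also have "\<dots> = 2 * U + 2 * (\<Sum>n\<le>N. (f (Suc n))\<^sup>2)"
      by (simp add: sum.distrib sum_distrib_left U_def)
    finally show ?thesis using shift by simp
  qed
  have pointwise: "(f n)\<^sup>2 \<le> 2 * sqrt (G * U)" if n: "n \<le> N" for n
  proof -
    have "(\<Sum>i = n..<Suc N. (f (Suc i))\<^sup>2 - (f i)\<^sup>2) = (f (Suc N))\<^sup>2 - (f n)\<^sup>2"
      using n by (intro sum_Suc_diff') auto
    then have "(f n)\<^sup>2 = - (\<Sum>i = n..<Suc N. (f (Suc i))\<^sup>2 - (f i)\<^sup>2)"
      using vanish[of "Suc N"] by simp
    also have "\<dots> = (\<Sum>i = n..<Suc N. (f i - f (Suc i)) * (f i + f (Suc i)))"
      unfolding sum_negf[symmetric] by (intro sum.cong) (auto simp: power2_eq_square algebra_simps)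
    also have "\<dots> \<le> (\<Sum>i = n..<Suc N. \<bar>f i - f (Suc i)\<bar> * \<bar>f i + f (Suc i)\<bar>)"
      by (intro sum_mono) (simp flip: abs_mult)
    also have "\<dots> \<le> (\<Sum>i\<le>N. \<bar>f i - f (Suc i)\<bar> * \<bar>f i + f (Suc i)\<bar>)"
      by (intro sum_mono2) auto
    also have "\<dots> \<le> L2_set (\<lambda>i. f i - f (Suc i)) {..N} * L2_set (\<lambda>i. f i + f (Suc i)) {..N}"
      by (rule L2_set_mult_ineq)
    also have "\<dots> \<le> sqrt G * sqrt (4 * U)"
      unfolding L2_set_def G_def[symmetric]
      by (intro mult_left_mono real_sqrt_le_mono sq) (simp add: G0)
    also have "\<dots> = 2 * sqrt (G * U)" by (simp add: real_sqrt_mult)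
    finally show ?thesis .
  qed
  define s where "s = sqrt (2 * sqrt (G * U))"
  have fs: "f n \<le> s" if "n \<le> N" for n
    unfolding s_def using pointwise[OF that] by (rule real_le_rsqrt)
  have s0: "0 \<le> s" using G0 U0 by (simp add: s_def)
  have "U \<le> (\<Sum>n\<le>N. s * f n)"
    unfolding U_def power2_eq_square by (intro sum_mono mult_right_mono) (auto simp: fs nonneg)
  also have "\<dots> = s * (\<Sum>n\<le>N. f n)" by (simp add: sum_distrib_left)
  also have "\<dots> \<le> s" using s0 mass mult_left_mono[of "\<Sum>n\<le>N. f n" 1 s] by simp
  finally have Us: "U \<le> s" .
  have s2: "s\<^sup>2 = 2 * sqrt (G * U)" using G0 U0 by (simp add: s_def)
  have "s ^ 4 = (s\<^sup>2)\<^sup>2" by simp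
  also have "\<dots> = 4 * (G * U)" unfolding s2 using G0 U0 by (simp add: power_mult_distrib)
  finally have "U ^ 4 \<le> 4 * (G * U)" using power_mono[OF Us U0, of 4] by simp
  then have "U * U ^ 3 \<le> U * (4 * G)" by (simp add: eval_nat_numeral algebra_simps)
  then have "U ^ 3 \<le> 4 * G" using U0 G0 by (cases "U = 0") auto
  then show ?thesis by (simp add: U_def G_def)
qed

text \<open>
  The discrete form of \<open>u' \<le> - a u\<^sup>3\<close>, under which \<open>1/u\<^sup>2\<close> grows at least at the rate \<open>2a\<close>. The
  claim is written without division so that \<open>u\<close> may vanish.
\<close>

lemma cubic_recursion_decay:
  fixes u :: "nat \<Rightarrow> real"
  assumes a: "0 \<le> a" "a \<le> 1" and u0: "u 0 \<le> 1" and nonneg: "\<And>n. 0 \<le> u n"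
    and rec: "\<And>n. u (Suc n) \<le> u n - a * (u n) ^ 3"
  shows "(u n)\<^sup>2 * (1 + 2 * a * real n) \<le> 1"
proof (induction n)
  case 0
  then show ?case using u0 nonneg[of 0] by (simp add: power_le_one)
next
  case (Suc n)
  define s where "s = (u n)\<^sup>2"
  have s0: "0 \<le> s" by (simp add: s_def)
  have IH: "s * (1 + 2 * a * real n) \<le> 1" using Suc by (simp add: s_def)
  have "s * 1 \<le> s * (1 + 2 * a * real n)" using a s0 by (intro mult_left_mono) auto
  then have s1: "s \<le> 1" using IH by linarith
  define y where "y = a * s"
  have y: "0 \<le> y" "y \<le> 1" using a s0 s1 by (auto simp: y_def mult_le_one)
  have "u (Suc n) \<le> u n * (1 - y)"
    using rec[of n] by (simp add: y_def s_def power2_eq_square power3_eq_cube algebra_simps)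
  then have "(u (Suc n))\<^sup>2 \<le> (u n * (1 - y))\<^sup>2" by (intro power_mono nonneg)
  then have step: "(u (Suc n))\<^sup>2 \<le> s * (1 - y)\<^sup>2" by (simp add: s_def power_mult_distrib)
  have "(u (Suc n))\<^sup>2 * (1 + 2 * a * real (Suc n)) \<le> s * (1 - y)\<^sup>2 * (1 + 2 * a * real (Suc n))"
    using step a by (intro mult_right_mono) auto
  also have "\<dots> = (1 - y)\<^sup>2 * (s * (1 + 2 * a * real n) + 2 * y)"
    by (simp add: y_def algebra_simps)
  also have "\<dots> \<le> (1 - y)\<^sup>2 * (1 + 2 * y)" using IH by (intro mult_left_mono) auto
  also have "\<dots> = 1 - y\<^sup>2 * (3 - 2 * y)" by (simp add: power2_eq_square algebra_simps)
  also have "\<dots> \<le> 1" using y by simp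
  finally show ?case .
qed

text \<open>
  Separating the linear term lets it cancel for a martingale, while the remainder is of second
  order in \<open>u\<close>.
\<close>

lemma exp_le_quadratic: "exp (u::real) \<le> 1 + u + u\<^sup>2 * exp \<bar>u\<bar>"
proof -
  obtain t where t: "\<bar>t\<bar> \<le> \<bar>u\<bar>" and "exp u = (\<Sum>m<2. u ^ m / fact m) + exp t / fact 2 * u ^ 2"
    using Maclaurin_exp_le[of u 2] by blast
  then have "exp u = 1 + u + exp t / 2 * u\<^sup>2" by (simp add: eval_nat_numeral)
  moreover have "exp t / 2 * u\<^sup>2 \<le> exp \<bar>u\<bar> * u\<^sup>2"
  proof (intro mult_right_mono)
    have "exp t \<le> exp \<bar>u\<bar>" using t by simp
    then show "exp t / 2 \<le> exp \<bar>u\<bar>" using exp_gt_zero[of t] by linarith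
  qed simp
  ultimately show ?thesis by (simp add: mult.commute)
qed

text \<open>
  A lazy walk on the half-line that has a uniformly positive probability of a unit step to the
  right, increments with a uniformly bounded exponential moment, and no drift except at the left end
  point. Jumps of any length are allowed. The value 1 in the moment condition is a normalization
  that makes the one-step growth factor below equal to \<open>1 + l\<^sup>2\<close>.
\<close>

locale half_line_walk = symmetric_walk P for P :: "nat \<Rightarrow> nat \<Rightarrow> real" +
  assumes P_stay: "1 / 2 \<le> P x x"
    and P_up: "1 / 16 \<le> P x (Suc x)"
    and exp_moment: "avg (\<lambda>y. (real y - real x)\<^sup>2 * exp \<bar>real y - real x\<bar>) x \<le> 1"
    and drift: "0 < x \<Longrightarrow> avg (\<lambda>y. real y - real x) x = 0"
begin

text \<open>
  The return probability after \<open>2n\<close> steps is the squared \<open>\<ell>\<^sup>2\<close> norm of the row \<open>p n x\<close>. One more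
  step decreases it by at least 1/32 times the energy, and the Nash inequality bounds the energy from
  below by a quarter of the cube.
\<close>

lemma return_rec:
  "p (Suc n + Suc n) x x \<le> p (n + n) x x - 1 / 128 * (p (n + n) x x) ^ 3"
proof -
  define f where "f = (\<lambda>z. p n x z)"
  have f_avg: "avg f = (\<lambda>z. p (Suc n) x z)"
    by (rule ext) (simp add: f_def p_sym[of _ x] del: p.simps, simp add: p_sym[of _ x])
  obtain N where N: "reach n x \<union> reach (Suc n) x \<subseteq> {..N}"
    by (metis finite_Un finite_nat_iff_bounded_le finite_reach)
  have out: "f z = 0" "avg f z = 0" if "N < z" for z
  proof -
    have "z \<notin> reach n x" "z \<notin> reach (Suc n) x" using N that by auto
    then show "f z = 0" "avg f z = 0" unfolding f_avg by (simp_all only: f_def p_outside not_False_eq_True)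
  qed
  have f0: "0 \<le> f z" for z by (simp add: f_def p_nonneg)
  have U: "p (n + n) x x = (\<Sum>z\<le>N. (f z)\<^sup>2)"
    unfolding p_double using N
    by (intro sum.mono_neutral_cong_left) (auto simp: f_def p_outside power2_eq_square)
  have U': "p (Suc n + Suc n) x x = (\<Sum>z\<le>N. (avg f z)\<^sup>2)"
    unfolding p_double f_avg using N
    by (intro sum.mono_neutral_cong_left)
       (auto simp: p_outside power2_eq_square simp del: p.simps reach.simps)
  have "(\<Sum>z\<le>N. f z) = (\<Sum>z\<in>reach n x. f z)"
    using N by (intro sum.mono_neutral_right) (auto simp: f_def p_outside)
  then have mass: "(\<Sum>z\<le>N. f z) \<le> 1" by (simp add: f_def p_sum)
  have "(avg f z)\<^sup>2 + 1 / 32 * (f z - f (Suc z))\<^sup>2 \<le> avg (\<lambda>y. (f y)\<^sup>2) z" for z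
  proof -
    have "1 / 2 * (1 / 16) \<le> P z z * P z (Suc z)"
      by (intro mult_mono P_stay P_up P_nonneg) auto
    then have "1 / 32 * (f z - f (Suc z))\<^sup>2 \<le> P z z * P z (Suc z) * (f z - f (Suc z))\<^sup>2"
      by (intro mult_right_mono) auto
    then show ?thesis using variance_lower_bound[of z "Suc z" f z] by simp
  qed
  then have "(\<Sum>z\<le>N. (avg f z)\<^sup>2 + 1 / 32 * (f z - f (Suc z))\<^sup>2) \<le> (\<Sum>z\<le>N. avg (\<lambda>y. (f y)\<^sup>2) z)"
    by (intro sum_mono)
  also have "\<dots> \<le> (\<Sum>z\<le>N. (f z)\<^sup>2)"
    by (intro sum_avg_le) (auto simp: out)
  finally have "(\<Sum>z\<le>N. (avg f z)\<^sup>2) + 1 / 32 * (\<Sum>z\<le>N. (f z - f (Suc z))\<^sup>2) \<le> (\<Sum>z\<le>N. (f z)\<^sup>2)"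
    by (simp add: sum.distrib sum_distrib_left)
  moreover have "(\<Sum>z\<le>N. (f z)\<^sup>2) ^ 3 \<le> 4 * (\<Sum>z\<le>N. (f z - f (Suc z))\<^sup>2)"
    by (intro nash_half_line f0 out mass)
  ultimately show ?thesis unfolding U U' by linarith
qed

lemma return_bound: "(p (n + n) x x)\<^sup>2 * (1 + real n / 64) \<le> 1"
  using cubic_recursion_decay[of "1 / 128" "\<lambda>n. p (n + n) x x" n] return_rec p_nonneg
  by simp

text \<open>
  Off the diagonal, the return probabilities at the two end points dominate, by the symmetry of the
  matrix and \<open>2ab \<le> a\<^sup>2 + b\<^sup>2\<close>.
\<close>

lemma even_bound: "p (n + n) x y \<le> 1 / sqrt (1 + real n / 64)"
proof -
  have ret: "p (n + n) z z \<le> 1 / sqrt (1 + real n / 64)" for z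
  proof -
    have "(p (n + n) z z * sqrt (1 + real n / 64))\<^sup>2 \<le> 1\<^sup>2"
      using return_bound[of n z] by (simp add: power_mult_distrib)
    then have "p (n + n) z z * sqrt (1 + real n / 64) \<le> 1" by (rule power2_le_imp_le) simp
    then show ?thesis by (simp add: pos_le_divide_eq add_pos_nonneg)
  qed
  let ?S = "reach n x \<union> reach n y"
  have sq: "(\<Sum>z\<in>?S. (p n w z)\<^sup>2) = p (n + n) w w" if "w \<in> {x, y}" for w
    unfolding p_double using that
    by (intro sum.mono_neutral_cong_right) (auto simp: p_outside power2_eq_square)
  have "p (n + n) x y = (\<Sum>z\<in>?S. p n x z * p n y z)"
    unfolding p_double by (intro sum.mono_neutral_left) (auto simp: p_outside)
  also have "\<dots> \<le> (\<Sum>z\<in>?S. ((p n x z)\<^sup>2 + (p n y z)\<^sup>2) / 2)"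
  proof (intro sum_mono)
    show "p n x z * p n y z \<le> ((p n x z)\<^sup>2 + (p n y z)\<^sup>2) / 2" for z
      using sum_squares_bound[of "p n x z" "p n y z"] by simp
  qed
  also have "\<dots> = (p (n + n) x x + p (n + n) y y) / 2"
    by (simp add: sum.distrib sq flip: sum_divide_distrib)
  also have "\<dots> \<le> 1 / sqrt (1 + real n / 64)" using ret[of x] ret[of y] by simp
  finally show ?thesis .
qed

lemma on_diagonal_bound: "p n x y \<le> 12 / sqrt (real n + 1)"
proof -
  define h where "h = n div 2"
  have "p n x y \<le> 1 / sqrt (1 + real h / 64)"
  proof (cases "even n")
    case True
    then have "n = h + h" by (auto simp: h_def)
    then show ?thesis using even_bound[of h x y] by simp
  next
    case False
    then have n: "n = Suc (h + h)" unfolding h_def by presburger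
    have "p n x y \<le> avg (\<lambda>_. 1 / sqrt (1 + real h / 64) * 1) x"
      unfolding n p.simps by (intro avg_mono) (use even_bound[of h] in simp)
    then show ?thesis unfolding avg_cmult by (simp add: avg_one)
  qed
  also have "\<dots> \<le> 12 / sqrt (real n + 1)"
  proof -
    have "n \<le> 2 * h + 1" unfolding h_def by presburger
    then have "real n \<le> 2 * real h + 1" by linarith
    then have "sqrt (real n + 1) \<le> sqrt (12\<^sup>2 * (1 + real h / 64))"
      by (intro real_sqrt_le_mono) (simp add: field_simps)
    also have "\<dots> = 12 * sqrt (1 + real h / 64)" by (subst real_sqrt_mult) simp
    finally show ?thesis by (simp add: field_simps add_pos_nonneg)
  qed
  finally show ?thesis .
qed

section \<open>Exponential moments and the off-diagonal bound\<close>

text \<open>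
  If one step multiplies \<open>g\<close> by at most \<open>1 + c\<close>, then up to the time \<open>1/c\<close> the growth stays below
  the constant \<open>e\<close>.
\<close>

lemma avg_growth_bound:
  assumes g: "\<And>x. avg g x \<le> (1 + c) * g x" and c: "0 \<le> c" and cn: "c * real n \<le> 1"
    and g0: "\<And>x. 0 \<le> g x"
  shows "(\<Sum>z\<in>reach n x. p n x z * g z) \<le> exp 1 * g x"
proof -
  have pow: "(avg ^^ n) g x \<le> (1 + c) ^ n * g x" for x
  proof (induction n arbitrary: x)
    case (Suc n)
    have "(avg ^^ Suc n) g x \<le> avg (\<lambda>x. (1 + c) ^ n * g x) x"
      using Suc by (simp add: avg_mono)
    also have "\<dots> \<le> (1 + c) ^ n * ((1 + c) * g x)"
      unfolding avg_cmult using g c by (intro mult_left_mono) auto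
    finally show ?case by (simp add: mult_ac)
  qed simp
  have "(1 + c) ^ n \<le> exp c ^ n" using c by (intro power_mono exp_ge_add_one_self) auto
  moreover have "exp c ^ n = exp (c * real n)" by (metis exp_of_nat_mult mult.commute)
  moreover have "exp (c * real n) \<le> exp 1" using cn by simp
  ultimately have "(1 + c) ^ n \<le> exp 1" by linarith
  then have "(1 + c) ^ n * g x \<le> exp 1 * g x" by (intro mult_right_mono g0)
  then show ?thesis using pow[of x] unfolding avg_pow_eq_sum by linarith
qed

lemma scaled_exp_moment:
  assumes "0 \<le> l" "l \<le> 1"
  shows "avg (\<lambda>y. (l * (real y - real x))\<^sup>2 * exp \<bar>l * (real y - real x)\<bar>) x \<le> l\<^sup>2"
proof -
  have "avg (\<lambda>y. (l * (real y - real x))\<^sup>2 * exp \<bar>l * (real y - real x)\<bar>) x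
      \<le> avg (\<lambda>y. l\<^sup>2 * ((real y - real x)\<^sup>2 * exp \<bar>real y - real x\<bar>)) x"
    using assms
    by (intro avg_mono)
       (auto simp: power_mult_distrib abs_mult mult.assoc mult_left_le_one_le intro!: mult_left_mono)
  also have "\<dots> \<le> l\<^sup>2 * 1" unfolding avg_cmult by (intro mult_left_mono exp_moment) auto
  finally show ?thesis by simp
qed

lemma drift_nonneg: "0 \<le> avg (\<lambda>y. real y - real x) x"
proof (cases "x = 0")
  case True
  then show ?thesis by (auto simp: avg_def P_nonneg intro!: sum_nonneg)
qed (simp add: drift)

text \<open>
  At the left end point the drift points to the right, which is the harmless direction for a
  decreasing test function.
\<close>

lemma avg_exp_minus:
  assumes "0 \<le> l" "l \<le> 1"
  shows "avg (\<lambda>y. exp (- l * real y)) x \<le> (1 + l\<^sup>2) * exp (- l * real x)"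
proof -
  let ?q = "\<lambda>y. (l * (real y - real x))\<^sup>2 * exp \<bar>l * (real y - real x)\<bar>"
  have "avg (\<lambda>y. exp (- l * real y)) x
      \<le> avg (\<lambda>y. exp (- l * real x) * (1 + (- l * (real y - real x) + ?q y))) x"
  proof (intro avg_mono)
    fix y
    have "exp (- l * real y) = exp (- l * real x) * exp (- l * (real y - real x))"
      by (simp add: algebra_simps flip: exp_add)
    also have "\<dots> \<le> exp (- l * real x) * (1 + (- l * (real y - real x) + ?q y))"
      using exp_le_quadratic[of "- l * (real y - real x)"] by (intro mult_left_mono) auto
    finally show "exp (- l * real y) \<le> exp (- l * real x) * (1 + (- l * (real y - real x) + ?q y))" .
  qed
  also have "\<dots> = exp (- l * real x) * (1 + (- l * avg (\<lambda>y. real y - real x) x + avg ?q x))"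
    unfolding avg_cmult avg_add by (simp add: avg_one)
  also have "\<dots> \<le> exp (- l * real x) * (1 + l\<^sup>2)"
    using scaled_exp_moment[OF assms, of x] mult_nonneg_nonneg[OF assms(1) drift_nonneg[of x]]
    by (intro mult_left_mono) auto
  finally show ?thesis by (simp add: mult.commute)
qed

text \<open>
  The increasing exponential would feel the drift at the left end point to first order. Its even
  version does not, since \<open>sinh\<close> vanishes at 0; elsewhere there is no drift.
\<close>

lemma avg_cosh:
  assumes "0 \<le> l" "l \<le> 1"
  shows "avg (\<lambda>y. cosh (l * real y)) x \<le> (1 + l\<^sup>2) * cosh (l * real x)"
proof -
  let ?q = "\<lambda>y. (l * (real y - real x))\<^sup>2 * exp \<bar>l * (real y - real x)\<bar>"
  have "avg (\<lambda>y. cosh (l * real y)) x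
      \<le> avg (\<lambda>y. cosh (l * real x) * (1 + ?q y) + l * sinh (l * real x) * (real y - real x)) x"
  proof (intro avg_mono)
    fix y
    define j where "j = l * (real y - real x)"
    have y: "l * real y = l * real x + j" by (simp add: j_def algebra_simps)
    have "exp (l * real x) * exp j \<le> exp (l * real x) * (1 + j + j\<^sup>2 * exp \<bar>j\<bar>)"
      by (intro mult_left_mono exp_le_quadratic) simp
    moreover have "exp (- (l * real x)) * exp (- j) \<le> exp (- (l * real x)) * (1 - j + j\<^sup>2 * exp \<bar>j\<bar>)"
      using exp_le_quadratic[of "- j"] by (intro mult_left_mono) simp_all
    ultimately have "exp (l * real y) + exp (- (l * real y))
        \<le> (exp (l * real x) + exp (- (l * real x))) * (1 + j\<^sup>2 * exp \<bar>j\<bar>)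
          + (exp (l * real x) - exp (- (l * real x))) * j"
      unfolding y by (simp add: exp_add exp_diff exp_minus divide_inverse algebra_simps)
    then show "cosh (l * real y)
        \<le> cosh (l * real x) * (1 + ?q y) + l * sinh (l * real x) * (real y - real x)"
      unfolding j_def[symmetric] cosh_field_def sinh_field_def
      by (simp add: field_simps j_def)
  qed
  also have "\<dots> = cosh (l * real x) * (1 + avg ?q x)
      + l * sinh (l * real x) * avg (\<lambda>y. real y - real x) x"
    unfolding avg_cmult avg_add by (simp add: avg_one)
  also have "l * sinh (l * real x) * avg (\<lambda>y. real y - real x) x = 0"
    using drift[of x] by (cases "x = 0") auto
  also have "cosh (l * real x) * (1 + avg ?q x) + 0 \<le> cosh (l * real x) * (1 + l\<^sup>2)"
    using scaled_exp_moment[OF assms, of x] by (simp add: cosh_real_nonneg mult_left_mono)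
  finally show ?thesis by (simp add: mult.commute)
qed

text \<open>
  The displacement to the left is measured by the decreasing exponential and the displacement to the
  right by \<open>2 cosh\<close>; the latter loses only a factor 2 compared with the increasing exponential.
\<close>

lemma exponential_tail:
  assumes l: "0 \<le> l" "l \<le> 1" "l\<^sup>2 * real n \<le> 1"
  shows "(\<Sum>z\<in>reach n x. p n x z * exp (l * \<bar>real x - real z\<bar>)) \<le> 3 * exp 1"
proof -
  have E1: "(\<Sum>z\<in>reach n x. p n x z * exp (- l * real z)) \<le> exp 1 * exp (- l * real x)"
    by (rule avg_growth_bound[where c = "l\<^sup>2"]) (use l avg_exp_minus in auto)
  have E2: "(\<Sum>z\<in>reach n x. p n x z * cosh (l * real z)) \<le> exp 1 * cosh (l * real x)"
    by (rule avg_growth_bound[where c = "l\<^sup>2"]) (use l avg_cosh in auto)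
  have "(\<Sum>z\<in>reach n x. p n x z * exp (l * \<bar>real x - real z\<bar>))
     \<le> (\<Sum>z\<in>reach n x. exp (l * real x) * (p n x z * exp (- l * real z))
          + 2 * exp (- (l * real x)) * (p n x z * cosh (l * real z)))"
  proof (intro sum_mono)
    fix z
    have "exp (l * \<bar>real x - real z\<bar>) \<le> exp (l * real x) * exp (- l * real z)
        + exp (- (l * real x)) * exp (l * real z)"
      by (cases "real z \<le> real x") (auto simp: algebra_simps simp flip: exp_add)
    also have "\<dots> \<le> exp (l * real x) * exp (- l * real z)
        + exp (- (l * real x)) * (2 * cosh (l * real z))"
      by (intro add_left_mono mult_left_mono) (auto simp: cosh_field_def)
    finally have "p n x z * exp (l * \<bar>real x - real z\<bar>) \<le> p n x z * (exp (l * real x) * exp (- l * real z)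
        + exp (- (l * real x)) * (2 * cosh (l * real z)))"
      by (intro mult_left_mono p_nonneg)
    then show "p n x z * exp (l * \<bar>real x - real z\<bar>) \<le> exp (l * real x) * (p n x z * exp (- l * real z))
          + 2 * exp (- (l * real x)) * (p n x z * cosh (l * real z))"
      by (simp add: algebra_simps)
  qed
  also have "\<dots> = exp (l * real x) * (\<Sum>z\<in>reach n x. p n x z * exp (- l * real z))
      + 2 * exp (- (l * real x)) * (\<Sum>z\<in>reach n x. p n x z * cosh (l * real z))"
    by (simp add: sum.distrib sum_distrib_left)
  also have "\<dots> \<le> exp (l * real x) * (exp 1 * exp (- l * real x))
      + 2 * exp (- (l * real x)) * (exp 1 * cosh (l * real x))"
    by (intro add_mono mult_left_mono E1 E2) auto
  also have "\<dots> \<le> exp 1 + 2 * exp 1"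
  proof -
    have "exp (l * real x) * (exp 1 * exp (- l * real x)) = exp 1"
      by (simp flip: exp_add)
    moreover have "exp (- (l * real x)) * cosh (l * real x) \<le> 1"
    proof -
      define u where "u = l * real x"
      have "0 \<le> u" using l by (simp add: u_def)
      then have le: "exp (- (2 * u)) \<le> 1" by simp
      have eq: "exp (- u) * cosh u = (1 + exp (- (2 * u))) / 2"
        by (simp add: cosh_field_def algebra_simps flip: exp_add)
      have "exp (- u) * cosh u \<le> 1" unfolding eq using le by simp
      then show ?thesis by (simp only: u_def)
    qed
    ultimately show ?thesis
      using mult_left_mono[of "exp (- (l * real x)) * cosh (l * real x)" 1 "2 * exp 1"]
      by (simp add: mult_ac)
  qed
  finally show ?thesis by simp
qed

text \<open>
  The time is split into two halves and the weight \<open>exp (l \<bar>x - y\<bar> / 2)\<close> is distributed over them by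
  the triangle inequality. In each of the two resulting terms one half is estimated by its
  maximum, of order \<open>l = 1/\<surd>(n + 1)\<close>, and the other one by its exponential moment. The factor 1/2
  in the exponent is the price for \<open>AB \<le> A\<^sup>2 + B\<^sup>2\<close>, which separates the two terms.
\<close>

lemma heat_kernel_bound:
  "p n x y \<le> 108 * exp 1 / sqrt (real n + 1) * exp (- (\<bar>real x - real y\<bar> / (2 * sqrt (real n + 1))))"
proof -
  define l where "l = 1 / sqrt (real n + 1)"
  define a b where "a = n div 2" and "b = n - a"
  have n: "n = a + b" by (simp add: a_def b_def)
  have l: "0 \<le> l" "l \<le> 1" by (auto simp: l_def)
  have l2: "l\<^sup>2 = 1 / (real n + 1)" by (simp add: l_def power_divide)
  have half: "12 / sqrt (real i + 1) \<le> 18 * l" "l\<^sup>2 * real i \<le> 1" if "i \<in> {a, b}" for i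
  proof -
    have "n \<le> 2 * i + 1" using that unfolding a_def b_def by auto
    then have "real n \<le> 2 * real i + 1" by linarith
    then have "sqrt (12\<^sup>2 * (real n + 1)) \<le> sqrt (18\<^sup>2 * (real i + 1))"
      by (intro real_sqrt_le_mono) simp
    then have "12 * sqrt (real n + 1) \<le> 18 * sqrt (real i + 1)"
      unfolding real_sqrt_mult by simp
    then show "12 / sqrt (real i + 1) \<le> 18 * l"
      by (simp add: l_def field_simps add_pos_nonneg)
    have "i \<le> n" using that n by auto
    then show "l\<^sup>2 * real i \<le> 1" unfolding l2 by (simp add: field_simps)
  qed
  have bound: "p i z w \<le> 18 * l" if "i \<in> {a, b}" for i z w
    using on_diagonal_bound[of i z w] half(1)[OF that] by linarith
  let ?S = "reach a x \<union> reach b y"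
  let ?e = "\<lambda>u z. exp (l * \<bar>real u - real z\<bar>)"
  have tail: "(\<Sum>z\<in>?S. p i w z * ?e w z) \<le> 3 * exp 1" if "(i, w) \<in> {(a, x), (b, y)}" for i w
  proof -
    have "(\<Sum>z\<in>?S. p i w z * ?e w z) = (\<Sum>z\<in>reach i w. p i w z * ?e w z)"
      using that by (intro sum.mono_neutral_right) (auto simp: p_outside)
    then show ?thesis using exponential_tail[of l i w] l half(2)[of i] that by auto
  qed
  have "p n x y * exp (l * \<bar>real x - real y\<bar> / 2)
      = (\<Sum>z\<in>?S. p a x z * p b y z * exp (l * \<bar>real x - real y\<bar> / 2))"
    unfolding n p_add sum_distrib_right p_sym[of b y]
    by (intro sum.mono_neutral_left) (auto simp: p_outside)
  also have "\<dots> \<le> (\<Sum>z\<in>?S. 18 * l * (p a x z * ?e x z) + 18 * l * (p b y z * ?e y z))"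
  proof (intro sum_mono)
    fix z
    define A B where "A = exp (l * \<bar>real x - real z\<bar> / 2)" and "B = exp (l * \<bar>real y - real z\<bar> / 2)"
    have "l * \<bar>real x - real y\<bar> \<le> l * (\<bar>real x - real z\<bar> + \<bar>real y - real z\<bar>)"
      using l by (intro mult_left_mono) auto
    then have "exp (l * \<bar>real x - real y\<bar> / 2) \<le> A * B"
      by (simp add: A_def B_def algebra_simps add_divide_distrib flip: exp_add)
    also have "\<dots> \<le> A\<^sup>2 + B\<^sup>2"
    proof -
      have "0 \<le> A * B" by (simp add: A_def B_def)
      then show ?thesis using sum_squares_bound[of A B] by linarith
    qed
    also have "\<dots> = ?e x z + ?e y z"
      by (simp add: A_def B_def flip: exp_double)
    finally have "p a x z * p b y z * exp (l * \<bar>real x - real y\<bar> / 2)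
        \<le> p a x z * p b y z * (?e x z + ?e y z)"
      by (intro mult_left_mono mult_nonneg_nonneg p_nonneg)
    also have "\<dots> = p b y z * (p a x z * ?e x z) + p a x z * (p b y z * ?e y z)"
      by (simp add: algebra_simps)
    also have "\<dots> \<le> 18 * l * (p a x z * ?e x z) + 18 * l * (p b y z * ?e y z)"
      by (intro add_mono mult_right_mono bound mult_nonneg_nonneg p_nonneg) auto
    finally show "p a x z * p b y z * exp (l * \<bar>real x - real y\<bar> / 2)
        \<le> 18 * l * (p a x z * ?e x z) + 18 * l * (p b y z * ?e y z)" .
  qed
  also have "\<dots> = 18 * l * (\<Sum>z\<in>?S. p a x z * ?e x z) + 18 * l * (\<Sum>z\<in>?S. p b y z * ?e y z)"
    by (simp add: sum.distrib sum_distrib_left)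
  also have "\<dots> \<le> 18 * l * (3 * exp 1) + 18 * l * (3 * exp 1)"
    using l tail by (intro add_mono mult_left_mono) auto
  finally have "p n x y * exp (l * \<bar>real x - real y\<bar> / 2) \<le> 108 * exp 1 * l" by (simp add: mult_ac)
  then show ?thesis by (simp add: l_def exp_minus field_simps)
qed

end

text \<open>
  Exponential decay in \<open>\<bar>x - y\<bar> / \<surd>k\<close> beats every negative power, which is all that (UE\<open>\<^sub>\<beta>\<close>)
  asks for. The odd power \<open>2N + 1\<close> keeps the exponent positive for \<open>N = 0\<close>.
\<close>

lemma exp_le_polynomial:
  assumes "0 \<le> (u::real)"
  shows "exp (- u / 2) \<le> (2 * real (2 * N + 1)) ^ (2 * N + 1) * (1 + u\<^sup>2) powr (- real N)"
proof -
  define M where "M = 2 * N + 1"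
  have M: "0 < M" by (simp add: M_def)
  have "(1 + u\<^sup>2) ^ N \<le> ((1 + u)\<^sup>2) ^ N"
    using assms by (intro power_mono) (auto simp: power2_eq_square algebra_simps)
  also have "\<dots> \<le> (1 + u) ^ M"
    unfolding power_mult[symmetric] M_def using assms by (intro power_increasing) auto
  also have "\<dots> \<le> (2 * real M * (1 + u / 2 / real M)) ^ M"
    using assms M by (intro power_mono) (auto simp: field_simps)
  also have "\<dots> = (2 * real M) ^ M * (1 + u / 2 / real M) ^ M" by (rule power_mult_distrib)
  also have "\<dots> \<le> (2 * real M) ^ M * exp (u / 2)"
    using assms M by (intro mult_left_mono exp_ge_one_plus_x_over_n_power_n) (auto intro: order_trans[of _ 0])
  finally have "(1 + u\<^sup>2) ^ N \<le> (2 * real M) ^ M * exp (u / 2)" .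
  moreover have "(1 + u\<^sup>2) powr (- real N) = 1 / (1 + u\<^sup>2) ^ N"
    by (simp add: powr_minus powr_realpow add_pos_nonneg divide_inverse)
  moreover have "0 < (1 + u\<^sup>2) ^ N" by (simp add: add_pos_nonneg)
  ultimately show ?thesis unfolding M_def[symmetric] by (simp add: exp_minus field_simps)
qed

section \<open>The necklace and its random walk\<close>

text \<open>
  The lengths of the cells are arbitrary in everything that concerns (LB), (D\<open>\<^sub>\<beta>\<close>) and
  (UE\<open>\<^sub>\<beta>\<close>). A cell of length 1 has a chord that coincides with its only edge; the two weights
  then add up.
\<close>

locale necklace =
  fixes L :: "nat \<Rightarrow> nat"
  assumes L_pos: "0 < L i"
begin

definition node :: "nat \<Rightarrow> nat" where
  "node i = (\<Sum>k<i. L k)"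

definition cell :: "nat \<Rightarrow> nat" where
  "cell n = (LEAST i. n < node (Suc i))"

definition len :: "nat \<Rightarrow> nat" where
  "len n = L (cell n)"

text \<open>
  Under the linear potential \<open>n\<close>, an edge of weight \<open>w\<close> and length \<open>l\<close> carries the current \<open>w l\<close>.
  The weight of the rail edges in a cell makes the total current through the cell equal to 1
  (lemma \<open>current\<close>), so that the current is conserved at every positive vertex and the walk has no drift
  there. The chord is so light that the exponential second moment of a jump along it,
  \<open>chord \<cdot> l\<^sup>2 \<cdot> exp l\<close>, equals 1.
\<close>

definition rail :: "nat \<Rightarrow> real" where
  "rail n = 1 - exp (- real (len n)) / real (len n)"

definition chord :: "nat \<Rightarrow> real" where
  "chord n = exp (- real (len n)) / (real (len n))\<^sup>2"

text \<open>
  Each edge other than a loop is recorded once, at its smaller end point: the value is 0 unless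
  \<open>x < y\<close>.
\<close>

definition fwd :: "nat \<Rightarrow> nat \<Rightarrow> real" where
  "fwd x y = (if y = Suc x then rail x else 0)
         + (if x = node (cell x) \<and> y = node (Suc (cell x)) then chord x else 0)"

text \<open>
  The loops are chosen such that every vertex has measure 8. As the other edges at a vertex have
  total weight at most 4, the walk stays where it is with probability at least 1/2.
\<close>

definition \<mu> :: "nat \<Rightarrow> nat \<Rightarrow> real" where
  "\<mu> x y = fwd x y + fwd y x
         + (if x = y then 8 - (\<Sum>z\<le>node (Suc (cell x)). fwd x z + fwd z x) else 0)"

lemma node_Suc: "node (Suc i) = node i + L i"
  by (simp add: node_def)

lemma strict_mono_node: "strict_mono node"
  by (simp add: strict_mono_Suc_iff node_Suc L_pos)

lemmas node_less = strict_mono_less[OF strict_mono_node]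
  and node_eq = strict_mono_eq[OF strict_mono_node]

lemma node_0: "node 0 = 0"
  by (simp add: node_def)

lemma less_node_Suc_cell: "n < node (Suc (cell n))"
  unfolding cell_def
proof (rule LeastI)
  show "n < node (Suc n)" using strict_mono_imp_increasing[OF strict_mono_node, of "Suc n"] by simp
qed

lemma node_cell_le: "node (cell n) \<le> n"
proof (cases "cell n")
  case (Suc j)
  then have "\<not> n < node (Suc j)" using not_less_Least[of j "\<lambda>i. n < node (Suc i)"] by (simp add: cell_def)
  then show ?thesis using Suc by simp
qed (simp add: node_0)

lemma cell_eqI: "node i \<le> n \<Longrightarrow> n < node (Suc i) \<Longrightarrow> cell n = i"
  using less_node_Suc_cell[of n] node_cell_le[of n]
  by (meson less_Suc_eq_le nle_le order.strict_trans1 node_less)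

lemma cell_node: "cell (node i) = i"
  by (intro cell_eqI) (simp_all add: node_less)

lemma node_Suc_cell: "node (Suc (cell n)) = node (cell n) + len n"
  by (simp add: node_Suc len_def)

lemma len_pos: "0 < len n"
  by (simp add: len_def L_pos)

lemma len_ge_1: "1 \<le> real (len n)"
  using len_pos[of n] by linarith

lemma cell_Suc:
  "cell (Suc n) = (if Suc n = node (Suc (cell n)) then Suc (cell n) else cell n)"
  using less_node_Suc_cell[of n] node_cell_le[of n]
  by (auto simp: cell_node intro!: cell_eqI)

lemma node_Suc_iff: "Suc n = node (cell (Suc n)) \<longleftrightarrow> Suc n = node (Suc (cell n))"
  using node_cell_le[of n] by (auto simp: cell_Suc)

lemma rail_bounds: "1 / 2 \<le> rail n" "rail n \<le> 1"
proof -
  have "exp (- real (len n)) \<le> exp (- 1)" using len_ge_1[of n] by simp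
  also have "exp (- 1 :: real) \<le> 1 / 2"
    using exp_ge_add_one_self[of 1] by (simp add: exp_minus field_simps)
  finally have "exp (- real (len n)) \<le> 1 / 2" .
  then have "exp (- real (len n)) / real (len n) \<le> (1 / 2) / 1"
    using len_ge_1[of n] by (intro frac_le) auto
  then show "1 / 2 \<le> rail n" by (simp add: rail_def)
  show "rail n \<le> 1" by (simp add: rail_def)
qed

lemma chord_pos: "0 < chord n"
  using len_pos[of n] by (simp add: chord_def)

lemma chord_le_1: "chord n \<le> 1"
proof -
  have "exp (- real (len n)) \<le> 1" by simp
  moreover have "1 \<le> (real (len n))\<^sup>2" using len_ge_1[of n] by (simp add: one_le_power)
  ultimately show ?thesis unfolding chord_def
    by (meson divide_le_eq_1_pos less_le_trans order_trans zero_less_one)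
qed

lemma current: "rail n + chord n * real (len n) = 1"
  using len_pos[of n] by (simp add: rail_def chord_def power2_eq_square)

lemma fwd_nonneg: "0 \<le> fwd x y"
  using rail_bounds[of x] chord_pos[of x] by (simp add: fwd_def)

lemma fwd_less: "fwd x y \<noteq> 0 \<Longrightarrow> x < y"
  using less_node_Suc_cell[of x] by (auto simp: fwd_def split: if_splits)

lemma fwd_le: "fwd x y \<noteq> 0 \<Longrightarrow> y \<le> node (Suc (cell x))"
  using less_node_Suc_cell[of x] by (auto simp: fwd_def split: if_splits)

lemma sum_fwd_up:
  assumes "finite S" "{..node (Suc (cell x))} \<subseteq> S"
  shows "(\<Sum>y\<in>S. fwd x y * f (real y - real x))
    = rail x * f 1 + (if x = node (cell x) then chord x * f (real (len x)) else 0)"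
proof -
  define g where "g = (\<lambda>y. f (real y - real x))"
  have S: "Suc x \<in> S" "node (Suc (cell x)) \<in> S" using assms(2) less_node_Suc_cell[of x] by auto
  have "(\<Sum>y\<in>S. fwd x y * g y)
     = (\<Sum>y\<in>S. (if y = Suc x then rail x * g y else 0)
         + (if y = node (Suc (cell x)) then (if x = node (cell x) then chord x * g y else 0) else 0))"
    by (intro sum.cong) (auto simp: fwd_def algebra_simps)
  also have "\<dots> = rail x * g (Suc x) + (if x = node (cell x) then chord x * g (node (Suc (cell x))) else 0)"
    using assms(1) S by (simp add: sum.distrib)
  also have "\<dots> = rail x * f 1 + (if x = node (cell x) then chord x * f (real (len x)) else 0)"
    using node_Suc_cell[of x] by (cases "x = node (cell x)") (simp_all add: g_def)
  finally show ?thesis by (simp only: g_def)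
qed

lemma sum_fwd_down_0: "(\<Sum>y\<in>S. fwd y 0 * g y) = 0"
  using fwd_less by (intro sum.neutral) fastforce

text \<open>
  The edges to the left of \<open>x + 1\<close> belong to the cell of \<open>x\<close>, not to that of \<open>x + 1\<close>; the vertex is
  written as a successor for this reason.
\<close>

lemma sum_fwd_down:
  assumes "finite S" "{..node (Suc (cell (Suc x)))} \<subseteq> S"
  shows "(\<Sum>y\<in>S. fwd y (Suc x) * f (real y - real (Suc x)))
    = rail x * f (- 1) + (if Suc x = node (Suc (cell x)) then chord x * f (- real (len x)) else 0)"
proof -
  define g where "g = (\<lambda>y. f (real y - real (Suc x)))"
  have same_cell: "(y = node (cell y) \<and> Suc x = node (Suc (cell y)))
      \<longleftrightarrow> (y = node (cell x) \<and> Suc x = node (Suc (cell x)))" for y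
  proof
    assume *: "y = node (cell y) \<and> Suc x = node (Suc (cell y))"
    then have "node (cell y) \<le> x" using node_less[of "cell y" "Suc (cell y)"] by simp
    then have "cell x = cell y" using * by (intro cell_eqI) auto
    then show "y = node (cell x) \<and> Suc x = node (Suc (cell x))" using * by simp
  qed (simp add: cell_node)
  have chord_node: "chord (node (cell x)) = chord x" by (simp add: chord_def len_def cell_node)
  have "x < node (Suc (cell (Suc x)))" using less_node_Suc_cell[of "Suc x"] by simp
  then have S: "x \<in> S" "node (cell x) \<in> S" using assms(2) node_cell_le[of x] by auto
  have "(\<Sum>y\<in>S. fwd y (Suc x) * g y)
     = (\<Sum>y\<in>S. (if y = x then rail x * g y else 0)
         + (if y = node (cell x) then (if Suc x = node (Suc (cell x)) then chord x * g y else 0) else 0))"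
    unfolding fwd_def same_cell using chord_node by (intro sum.cong) (auto simp: algebra_simps)
  also have "\<dots> = rail x * g x + (if Suc x = node (Suc (cell x)) then chord x * g (node (cell x)) else 0)"
    using assms(1) S by (simp add: sum.distrib)
  also have "\<dots> = rail x * f (- 1)
      + (if Suc x = node (Suc (cell x)) then chord x * f (- real (len x)) else 0)"
  proof (cases "Suc x = node (Suc (cell x))")
    case True
    then have "real (Suc x) = real (node (cell x)) + real (len x)"
      using node_Suc_cell[of x] by (metis of_nat_add)
    then have "g (node (cell x)) = f (- real (len x))" unfolding g_def by (intro arg_cong[of _ _ f]) simp
    moreover have "g x = f (- 1)" by (simp add: g_def)
    ultimately show ?thesis using True by (simp only: if_True)
  qed (simp add: g_def)
  finally show ?thesis by (simp only: g_def)
qed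

lemma fwd_total: "(\<Sum>z\<le>node (Suc (cell x)). fwd x z + fwd z x) \<le> 4"
proof -
  have up: "(\<Sum>z\<le>node (Suc (cell x)). fwd x z) \<le> 2"
    using sum_fwd_up[of "{..node (Suc (cell x))}" x "\<lambda>_. 1"] rail_bounds(2)[of x] chord_le_1[of x]
    by (simp split: if_splits)
  have down: "(\<Sum>z\<le>node (Suc (cell x)). fwd z x) \<le> 2"
  proof (cases x)
    case 0
    then show ?thesis using sum_fwd_down_0[of "\<lambda>_. 1"] by simp
  next
    case (Suc n)
    then show ?thesis
      using sum_fwd_down[of "{..node (Suc (cell x))}" n "\<lambda>_. 1"] rail_bounds(2)[of n] chord_le_1[of n]
      by (simp split: if_splits)
  qed
  show ?thesis using up down by (simp add: sum.distrib)
qed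

lemma fwd_refl: "fwd x x = 0"
  using fwd_less by blast

lemma \<mu>_refl: "4 \<le> \<mu> x x"
  using fwd_total[of x] by (simp add: \<mu>_def fwd_refl)

lemma \<mu>_nonneg: "0 \<le> \<mu> x y"
  using \<mu>_refl[of x] by (cases "x = y") (auto simp: \<mu>_def fwd_nonneg)

lemma \<mu>_sym: "\<mu> x y = \<mu> y x"
  by (auto simp: \<mu>_def)

lemma \<mu>_le: "\<mu> x y \<noteq> 0 \<Longrightarrow> y \<le> node (Suc (cell x))"
  using fwd_le[of x y] fwd_less[of y x] less_node_Suc_cell[of x]
  by (cases "fwd x y = 0"; cases "fwd y x = 0") (auto simp: \<mu>_def split: if_splits)

lemma finite_\<mu>: "finite {y. \<mu> x y \<noteq> 0}"
  by (rule finite_subset[of _ "{..node (Suc (cell x))}"]) (auto dest: \<mu>_le)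

lemma sum_\<mu>: "(\<Sum>y\<le>node (Suc (cell x)). \<mu> x y) = 8"
proof -
  have "x \<in> {..node (Suc (cell x))}" using less_node_Suc_cell[of x] by simp
  then show ?thesis unfolding \<mu>_def sum.distrib by simp
qed

lemma sum_\<mu>_support: "(\<Sum>y | \<mu> x y \<noteq> 0. \<mu> x y) = 8"
  by (subst sum_\<mu>[of x, symmetric], intro sum.mono_neutral_left) (auto dest: \<mu>_le)

lemma sum_\<mu>_shift:
  assumes "g x = 0"
  shows "(\<Sum>y\<le>node (Suc (cell x)). \<mu> x y * g y)
    = (\<Sum>y\<le>node (Suc (cell x)). fwd x y * g y) + (\<Sum>y\<le>node (Suc (cell x)). fwd y x * g y)"
  unfolding sum.distrib[symmetric]
  by (intro sum.cong) (auto simp: \<mu>_def algebra_simps assms)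

definition P :: "nat \<Rightarrow> nat \<Rightarrow> real" where
  "P x y = \<mu> x y / 8"

sublocale symmetric_walk P
proof
  show "(\<Sum>y | P x y \<noteq> 0. P x y) = 1" for x
    using sum_\<mu>_support[of x] by (simp add: P_def flip: sum_divide_distrib)
qed (use finite_\<mu> in \<open>auto simp: P_def \<mu>_nonneg \<mu>_sym\<close>)

lemma avg_eq:
  assumes "g x = 0"
  shows "avg g x
    = ((\<Sum>y\<le>node (Suc (cell x)). fwd x y * g y) + (\<Sum>y\<le>node (Suc (cell x)). fwd y x * g y)) / 8"
proof -
  have "avg g x = (\<Sum>y\<le>node (Suc (cell x)). P x y * g y)"
    by (intro avg_eq_sum) (auto simp: nb_def P_def dest: \<mu>_le)
  then show ?thesis
    using sum_\<mu>_shift[of g x, OF assms] by (simp add: P_def flip: sum_divide_distrib)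
qed

text \<open>
  The exponential second moment of the jumps in one direction. Two directions and the division by
  the measure 8 give the bound 1.
\<close>

lemma cell_moment:
  "rail n * exp 1 + chord n * ((real (len n))\<^sup>2 * exp (real (len n))) \<le> 4"
proof -
  have "chord n * ((real (len n))\<^sup>2 * exp (real (len n))) = 1"
    using len_pos[of n] by (simp add: chord_def flip: exp_add)
  moreover have "rail n * exp 1 \<le> 1 * 3"
    using rail_bounds[of n] exp_le by (intro mult_mono) auto
  ultimately show ?thesis by simp
qed

lemma rail_le_\<mu>: "rail x \<le> \<mu> x (Suc x)"
proof -
  have "fwd x (Suc x) = rail x + (if x = node (cell x) \<and> Suc x = node (Suc (cell x)) then chord x else 0)"
    by (simp add: fwd_def)
  then have "rail x \<le> fwd x (Suc x)" using chord_pos[of x] by simp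
  then show ?thesis using fwd_nonneg[of "Suc x" x] by (simp add: \<mu>_def)
qed

sublocale half_line_walk P
proof
  fix x
  show "1 / 2 \<le> P x x" using \<mu>_refl[of x] by (simp add: P_def)
  show "1 / 16 \<le> P x (Suc x)" using rail_bounds(1)[of x] rail_le_\<mu>[of x] by (simp add: P_def)
next
  fix x
  let ?S = "{..node (Suc (cell x))}"
  define f :: "real \<Rightarrow> real" where "f u = u\<^sup>2 * exp \<bar>u\<bar>" for u
  have f: "f 1 = exp 1" "f (- 1) = exp 1" "f 0 = 0"
    "f (real (len n)) = (real (len n))\<^sup>2 * exp (real (len n))"
    "f (- real (len n)) = (real (len n))\<^sup>2 * exp (real (len n))" for n
    by (simp_all add: f_def)
  have long: "0 \<le> chord n * ((real (len n))\<^sup>2 * exp (real (len n)))" for n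
    using chord_pos[of n] by (intro mult_nonneg_nonneg) auto
  have up: "(\<Sum>y\<in>?S. fwd x y * f (real y - real x)) \<le> 4"
    using cell_moment[of x] long[of x] by (subst sum_fwd_up) (auto simp only: f split: if_splits)
  have down: "(\<Sum>y\<in>?S. fwd y x * f (real y - real x)) \<le> 4"
  proof (cases x)
    case 0
    then show ?thesis using sum_fwd_down_0[of "\<lambda>y. f (real y - real x)"] by simp
  next
    case (Suc n)
    show ?thesis unfolding Suc
      using cell_moment[of n] long[of n] by (subst sum_fwd_down) (auto simp only: f split: if_splits)
  qed
  have "avg (\<lambda>y. f (real y - real x)) x \<le> 1" using up down by (subst avg_eq) (auto simp: f)
  then show "avg (\<lambda>y. (real y - real x)\<^sup>2 * exp \<bar>real y - real x\<bar>) x \<le> 1" by (simp only: f_def)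
next
  fix x :: nat assume "0 < x"
  then obtain n where x: "x = Suc n" using gr0_conv_Suc by blast
  let ?S = "{..node (Suc (cell x))}"
  have up: "(\<Sum>y\<in>?S. fwd x y * (real y - real x))
      = rail x * 1 + (if x = node (cell x) then chord x * real (len x) else 0)"
    by (rule sum_fwd_up[where f = "\<lambda>u. u"]) auto
  have down: "(\<Sum>y\<in>?S. fwd y x * (real y - real x))
      = rail n * (- 1) + (if Suc n = node (Suc (cell n)) then chord n * (- real (len n)) else 0)"
    unfolding x by (rule sum_fwd_down[where f = "\<lambda>u. u"]) auto
  have "(\<Sum>y\<in>?S. fwd x y * (real y - real x)) + (\<Sum>y\<in>?S. fwd y x * (real y - real x)) = 0"
  proof (cases "Suc n = node (Suc (cell n))")
    case True
    then have "x = node (cell x)" unfolding x node_Suc_iff .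
    then show ?thesis unfolding up down using True current[of x] current[of n] by simp
  next
    case False
    then have "x \<noteq> node (cell x)" unfolding x node_Suc_iff .
    moreover have "rail x = rail n" using False by (simp add: x rail_def len_def cell_Suc)
    ultimately show ?thesis unfolding up down using False by simp
  qed
  then show "avg (\<lambda>y. real y - real x) x = 0" by (subst avg_eq) auto
qed

section \<open>The graph distance\<close>

text \<open>
  The second coordinate, next to the cell, of a Lipschitz map from the graph to the plane.
\<close>

definition height :: "nat \<Rightarrow> int" where
  "height n = min (int n - int (node (cell n))) (int (node (Suc (cell n))) - int n)"

abbreviation edge :: "nat \<Rightarrow> nat \<Rightarrow> bool" where
  "edge \<equiv> adj UNIV \<mu>"

abbreviation dst :: "nat \<Rightarrow> nat \<Rightarrow> nat" where
  "dst \<equiv> gdist UNIV \<mu>"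

lemma edge_iff: "edge x y \<longleftrightarrow> \<mu> x y \<noteq> 0"
  using \<mu>_nonneg[of x y] by (auto simp: adj_def)

lemma fwd_lipschitz:
  assumes "fwd x y \<noteq> 0"
  shows "\<bar>int (cell x) - int (cell y)\<bar> \<le> 1" "\<bar>height x - height y\<bar> \<le> 1"
proof -
  consider "y = Suc x" "Suc x \<noteq> node (Suc (cell x))" | "y = Suc x" "Suc x = node (Suc (cell x))"
    | "x = node (cell x)" "y = node (Suc (cell x))"
    using assms by (auto simp: fwd_def split: if_splits)
  then have "\<bar>int (cell x) - int (cell y)\<bar> \<le> 1 \<and> \<bar>height x - height y\<bar> \<le> 1"
  proof cases
    case 1
    then have "cell y = cell x" by (simp add: cell_Suc)
    then show ?thesis by (simp add: height_def 1)
  next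
    case 2
    then have y: "y = node (Suc (cell x))" by simp
    then have c: "cell y = Suc (cell x)" by (simp only: cell_node)
    have "height y = 0"
      using y node_less[of "Suc (cell x)" "Suc (Suc (cell x))"] unfolding height_def c by simp
    moreover have "0 \<le> height x" "height x \<le> 1"
      using 2 node_cell_le[of x] by (auto simp: height_def)
    ultimately show ?thesis by (simp add: c)
  next
    case 3
    then have c: "cell y = Suc (cell x)" by (simp only: cell_node)
    have "height y = 0"
      using 3(2) node_less[of "Suc (cell x)" "Suc (Suc (cell x))"] unfolding height_def c by simp
    moreover have "height x = 0"
      using 3(1) less_node_Suc_cell[of x] unfolding height_def by simp
    ultimately show ?thesis by (simp add: c)
  qed
  then show "\<bar>int (cell x) - int (cell y)\<bar> \<le> 1" "\<bar>height x - height y\<bar> \<le> 1" by auto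
qed

text \<open>
  A rail edge changes either coordinate by at most one, and a chord joins neighbouring cells at points
  of height 0.
\<close>

lemma edge_lipschitz:
  assumes "edge x y"
  shows "\<bar>int (cell x) - int (cell y)\<bar> \<le> 1 \<and> \<bar>height x - height y\<bar> \<le> 1"
proof -
  have "fwd x y \<noteq> 0 \<or> fwd y x \<noteq> 0 \<or> x = y" using assms by (cases "x = y") (auto simp: edge_iff \<mu>_def)
  then show ?thesis using fwd_lipschitz[of x y] fwd_lipschitz[of y x] by auto
qed

lemma path_lipschitz:
  "(edge ^^ n) x y \<Longrightarrow> \<bar>int (cell x) - int (cell y)\<bar> \<le> int n \<and> \<bar>height x - height y\<bar> \<le> int n"
proof (induction n arbitrary: y)
  case (Suc n)
  then obtain z where "(edge ^^ n) x z" "edge z y" by auto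
  then show ?case using Suc.IH[of z] edge_lipschitz[of z y] by auto
qed simp

lemma edge_Suc: "edge x (Suc x)"
  using rail_bounds(1)[of x] rail_le_\<mu>[of x] by (simp add: adj_def)

lemma edge_node: "edge (node i) (node (Suc i))"
proof -
  have "0 < fwd (node i) (node (Suc i))"
    using rail_bounds(1)[of "node i"] chord_pos[of "node i"] by (simp add: fwd_def cell_node)
  then show ?thesis using fwd_nonneg[of "node (Suc i)" "node i"] node_eq[of i "Suc i"]
    by (simp add: adj_def \<mu>_def)
qed

lemma edge_sym: "edge x y \<Longrightarrow> edge y x"
  by (simp add: adj_def \<mu>_sym)

lemma path_sym: "(edge ^^ n) x y \<Longrightarrow> (edge ^^ n) y x"
proof (induction n arbitrary: y)
  case (Suc n)
  then obtain z where "(edge ^^ n) x z" "edge z y" by auto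
  then have "edge y z" "(edge ^^ n) z x" using Suc.IH edge_sym by auto
  then show ?case by (rule relpowp_Suc_I2)
qed simp

lemma path_rail: "(edge ^^ n) x (x + n)"
proof (induction n)
  case (Suc n)
  then show ?case using edge_Suc[of "x + n"] by (auto intro: relpowp_Suc_I)
qed simp

lemma path_nodes: "(edge ^^ n) (node i) (node (i + n))"
proof (induction n)
  case (Suc n)
  then show ?case using edge_node[of "i + n"] by (auto intro: relpowp_Suc_I)
qed simp

lemma path_exists: "(edge ^^ nat \<bar>int x - int y\<bar>) x y"
proof (cases "x \<le> y")
  case True
  then show ?thesis using path_rail[of "y - x" x] by (simp add: nat_diff_distrib)
next
  case False
  then show ?thesis using path_sym[OF path_rail[of "x - y" y]] by (simp add: nat_diff_distrib)
qed

lemma dst_path: "(edge ^^ dst x y) x y"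
  unfolding gdist_def using path_exists by (rule LeastI)

lemma dst_le: "(edge ^^ n) x y \<Longrightarrow> dst x y \<le> n"
  unfolding gdist_def by (rule Least_le)

lemma dst_le_abs: "real (dst x y) \<le> \<bar>real x - real y\<bar>"
  using dst_le[OF path_exists, of x y] by linarith

lemma dst_lipschitz:
  "\<bar>int (cell x) - int (cell y)\<bar> \<le> int (dst x y)" "\<bar>height x - height y\<bar> \<le> int (dst x y)"
  using path_lipschitz[OF dst_path[of x y]] by auto

lemma height_inj:
  assumes "cell x = cell y" "height x = height y"
    and "(int x - int (node (cell x)) = height x) = (int y - int (node (cell y)) = height y)"
  shows "x = y"
  using assms unfolding height_def by (auto simp: min_def split: if_splits)

text \<open>
  The cell and the height are 1-Lipschitz for the graph distance and determine a vertex up to a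
  reflection of its cell. Hence a ball is no larger than two copies of a square in the plane.
\<close>

lemma card_ball:
  "finite {y. dst x y \<le> s}" "card {y. dst x y \<le> s} \<le> 2 * (2 * s + 1)\<^sup>2"
proof -
  define f where "f = (\<lambda>y. (int (cell y), height y, int y - int (node (cell y)) = height y))"
  define T where "T = {int (cell x) - int s..int (cell x) + int s}
      \<times> {height x - int s..height x + int s} \<times> (UNIV :: bool set)"
  have inj: "inj_on f {y. dst x y \<le> s}"
    by (intro inj_onI) (auto simp: f_def intro: height_inj)
  have sub: "f ` {y. dst x y \<le> s} \<subseteq> T"
  proof (intro image_subsetI)
    fix y assume "y \<in> {y. dst x y \<le> s}"
    then show "f y \<in> T" using dst_lipschitz[of x y] by (auto simp: f_def T_def)
  qed
  have fin: "finite T" by (simp add: T_def)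
  have card: "card T = 2 * (2 * s + 1)\<^sup>2"
    by (simp add: T_def card_cartesian_product power2_eq_square nat_add_distrib nat_mult_distrib)
  show "finite {y. dst x y \<le> s}" using inj sub fin by (rule inj_on_finite)
  show "card {y. dst x y \<le> s} \<le> 2 * (2 * s + 1)\<^sup>2"
    using card_inj_on_le[OF inj sub fin] card by simp
qed

section \<open>The weighted graph and its kernel\<close>

lemma vmeas_eq: "vmeas UNIV \<mu> x = 8"
  using sum_\<mu>_support[of x] by (simp add: vmeas_def edge_iff)

lemma smeas_eq: "smeas UNIV \<mu> E = 8 * real (card E)"
  by (simp add: smeas_def vmeas_eq)

lemma weighted_graph_necklace: "weighted_graph UNIV \<mu>"
  unfolding weighted_graph_def
proof (intro conjI ballI exI)
  fix x
  have sub: "{y. edge x y} \<subseteq> {y. dst x y \<le> 1}"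
    using dst_le[of 1 x] by (auto simp: relpowp_1)
  show "finite {y. edge x y}" using sub card_ball(1) by (rule finite_subset)
  have "card {y. edge x y} \<le> card {y. dst x y \<le> 1}" using card_ball(1) sub by (rule card_mono)
  also have "\<dots> \<le> 2 * (2 * 1 + 1)\<^sup>2" by (rule card_ball(2))
  finally show "card {y. edge x y} \<le> 18" by simp
qed (simp_all add: infinite_UNIV_nat \<mu>_sym \<mu>_nonneg)

lemma connected_graph_necklace: "connected_graph UNIV \<mu>"
  unfolding connected_graph_def using path_exists by (blast intro: relpowp_imp_rtranclp)

lemma LB_necklace: "LB UNIV \<mu>"
proof -
  have "1 / 4 < kernel UNIV \<mu> x x * vmeas UNIV \<mu> x" for x
    using \<mu>_refl[of x] by (simp add: kernel_def vmeas_eq)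
  then show ?thesis unfolding LB_def by (intro exI[of _ "1 / 4"]) auto
qed

lemma kernel_iter_eq: "kernel_iter UNIV \<mu> k x y = p k x y / 8"
proof (induction k arbitrary: x)
  case 0
  then show ?case by (simp add: vmeas_eq)
next
  case (Suc k)
  have step: "kernel UNIV \<mu> x z = P x z / 8" for z by (simp add: kernel_def vmeas_eq P_def)
  have "kernel_iter UNIV \<mu> (Suc k) x y = (\<Sum>\<^sub>\<infinity>z. P x z * p k z y / 8)"
    unfolding kernel_iter.simps Suc.IH vmeas_eq step by simp
  also have "\<dots> = (\<Sum>\<^sub>\<infinity>z\<in>nb x. P x z * p k z y / 8)"
    by (intro infsum_cong_neutral) (auto simp: P_outside)
  also have "\<dots> = p (Suc k) x y / 8"
    by (simp add: avg_def flip: sum_divide_distrib)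
  finally show ?case .
qed

section \<open>The variable exponent\<close>

text \<open>
  The quotient of logarithms is the exponent for which \<open>\<delta>\<^bsup>\<beta>\<^esup> = \<bar>x - y\<bar>\<^sup>2\<close>. Capping it at 4 gives
  \<open>\<rho> = min \<delta>\<^sup>4 \<bar>x - y\<bar>\<^sup>2\<close>. For \<open>\<delta> \<le> 1\<close> the power does not depend on the exponent, and the value 4
  makes this description of \<open>\<rho>\<close> valid there too.
\<close>

definition \<beta> :: "nat \<Rightarrow> nat \<Rightarrow> real" where
  "\<beta> x y = (if dst x y \<le> 1 then 4
     else min 4 (2 * ln \<bar>real x - real y\<bar> / ln (real (dst x y))))"

abbreviation rho_beta :: "nat \<Rightarrow> nat \<Rightarrow> real" where
  "rho_beta \<equiv> rho UNIV \<mu> \<beta>"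

lemma ratio_ge_2:
  assumes "2 \<le> dst x y"
  shows "2 \<le> 2 * ln \<bar>real x - real y\<bar> / ln (real (dst x y))"
proof -
  have "0 < ln (real (dst x y))" using assms by simp
  moreover have "ln (real (dst x y)) \<le> ln \<bar>real x - real y\<bar>"
    using assms dst_le_abs[of x y] by (subst ln_le_cancel_iff) auto
  ultimately show ?thesis by (simp add: pos_le_divide_eq)
qed

lemma \<beta>_bounds: "1 \<le> \<beta> x y" "\<beta> x y \<le> 4"
proof -
  show "\<beta> x y \<le> 4" by (simp add: \<beta>_def)
  show "1 \<le> \<beta> x y"
  proof (cases "dst x y \<le> 1")
    case False
    then have "1 \<le> 2 * ln \<bar>real x - real y\<bar> / ln (real (dst x y))"
      using ratio_ge_2[of x y] by linarith
    then show ?thesis using False by (simp add: \<beta>_def)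
  qed (simp add: \<beta>_def)
qed

lemma dst_powr_ratio:
  assumes "2 \<le> dst x y"
  shows "real (dst x y) powr (2 * ln \<bar>real x - real y\<bar> / ln (real (dst x y))) = (real x - real y)\<^sup>2"
proof -
  have pos: "0 < ln (real (dst x y))" "0 < \<bar>real x - real y\<bar>"
    using assms dst_le_abs[of x y] by auto
  have "real (dst x y) powr (2 * ln \<bar>real x - real y\<bar> / ln (real (dst x y)))
      = exp (2 * ln \<bar>real x - real y\<bar>)"
    using pos assms by (simp add: powr_def)
  also have "\<dots> = (exp (ln \<bar>real x - real y\<bar>))\<^sup>2" by (rule exp_double)
  also have "\<dots> = (real x - real y)\<^sup>2" using pos by simp
  finally show ?thesis .
qed

lemma rho_cases: "rho_beta x y = real (dst x y) ^ 4 \<or> rho_beta x y = (real x - real y)\<^sup>2"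
proof (cases "\<beta> x y = 4")
  case True
  then show ?thesis by (cases "dst x y = 0") (auto simp: rho_def)
next
  case False
  then have "2 \<le> dst x y" "\<beta> x y = 2 * ln \<bar>real x - real y\<bar> / ln (real (dst x y))"
    by (auto simp: \<beta>_def min_def split: if_splits)
  then show ?thesis using dst_powr_ratio[of x y] by (simp add: rho_def)
qed

lemma rho_le: "rho_beta x y \<le> (real x - real y)\<^sup>2"
proof (cases "2 \<le> dst x y")
  case True
  then have "rho_beta x y \<le> real (dst x y) powr (2 * ln \<bar>real x - real y\<bar> / ln (real (dst x y)))"
    unfolding rho_def by (intro powr_mono) (auto simp: \<beta>_def)
  then show ?thesis using dst_powr_ratio[OF True] by simp
next
  case False
  then have "dst x y = 0 \<or> dst x y = 1" by linarith
  then show ?thesis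
  proof
    assume "dst x y = 1"
    then have "1\<^sup>2 \<le> \<bar>real x - real y\<bar>\<^sup>2" using dst_le_abs[of x y] by (intro power_mono) auto
    then show ?thesis using \<open>dst x y = 1\<close> by (simp add: rho_def)
  qed (simp add: rho_def)
qed

lemma card_interval_real:
  assumes "0 \<le> a"
  shows "finite {y. \<bar>real x - real y\<bar> \<le> a}" "real (card {y. \<bar>real x - real y\<bar> \<le> a}) \<le> 2 * a + 1"
proof -
  define k where "k = nat \<lfloor>a\<rfloor>"
  have sub: "{y. \<bar>real x - real y\<bar> \<le> a} \<subseteq> {x - k..x + k}"
  proof
    fix y assume "y \<in> {y. \<bar>real x - real y\<bar> \<le> a}"
    then have "\<bar>int x - int y\<bar> \<le> \<lfloor>a\<rfloor>" by (subst le_floor_iff) auto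
    then show "y \<in> {x - k..x + k}" using assms by (auto simp: k_def)
  qed
  then show "finite {y. \<bar>real x - real y\<bar> \<le> a}" by (rule finite_subset) simp
  have "card {y. \<bar>real x - real y\<bar> \<le> a} \<le> card {x - k..x + k}" using sub by (intro card_mono) auto
  also have "\<dots> \<le> 2 * k + 1" by simp
  finally have "real (card {y. \<bar>real x - real y\<bar> \<le> a}) \<le> 2 * real k + 1" by linarith
  moreover have "real k \<le> a" using assms by (simp add: k_def)
  ultimately show "real (card {y. \<bar>real x - real y\<bar> \<le> a}) \<le> 2 * a + 1" by linarith
qed

text \<open>
  The exponent 4 is what makes the two kinds of points balance: there are \<open>O(s\<^sup>2 + 1)\<close> points with
  \<open>\<delta> \<le> s = r\<^bsup>1/4\<^esup>\<close>, and this is of the same order as the number of integers at distance at most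
  \<open>\<surd>r\<close>.
\<close>

lemma card_rho_ball:
  assumes r: "0 < r"
  shows "finite {y. rho_beta x y < r}" "real (card {y. rho_beta x y < r}) \<le> 18 * (sqrt r + 1)"
proof -
  \<comment> \<open>The radius at which the fourth power of the graph distance reaches \<open>r\<close>.\<close>
  define q where "q = sqrt (sqrt r)"
  define s where "s = nat \<lfloor>q\<rfloor>"
  have q0: "0 \<le> q" using r by (simp add: q_def)
  have q2: "q\<^sup>2 = sqrt r" using r by (simp add: q_def)
  have sq: "real s \<le> q" using q0 by (simp add: s_def)
  have q4: "q ^ 4 = r"
  proof -
    have "q ^ 4 = (q\<^sup>2)\<^sup>2" by simp
    then show ?thesis using r by (simp add: q2)
  qed
  have sub: "{y. rho_beta x y < r} \<subseteq> {y. \<bar>real x - real y\<bar> \<le> sqrt r} \<union> {y. dst x y \<le> s}"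
  proof
    fix y assume "y \<in> {y. rho_beta x y < r}"
    then consider "real (dst x y) ^ 4 < q ^ 4" | "(real x - real y)\<^sup>2 < r"
      using rho_cases[of x y] q4 by auto
    then show "y \<in> {y. \<bar>real x - real y\<bar> \<le> sqrt r} \<union> {y. dst x y \<le> s}"
    proof cases
      case 1
      then have "real (dst x y) < q" using q0 by (rule power_less_imp_less_base)
      then have "dst x y \<le> s" unfolding s_def by linarith
      then show ?thesis by simp
    next
      case 2
      then have "\<bar>real x - real y\<bar> < sqrt r" by (intro real_less_rsqrt) simp
      then show ?thesis by simp
    qed
  qed
  have fin: "finite ({y. \<bar>real x - real y\<bar> \<le> sqrt r} \<union> {y. dst x y \<le> s})"
    using card_interval_real(1)[of "sqrt r" x] card_ball(1)[of x s] r by simp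
  then show "finite {y. rho_beta x y < r}" using sub by (rule finite_subset[rotated])
  have "card {y. rho_beta x y < r} \<le> card ({y. \<bar>real x - real y\<bar> \<le> sqrt r} \<union> {y. dst x y \<le> s})"
    using fin sub by (rule card_mono)
  also have "\<dots> \<le> card {y. \<bar>real x - real y\<bar> \<le> sqrt r} + card {y. dst x y \<le> s}"
    by (rule card_Un_le)
  finally have "real (card {y. rho_beta x y < r})
      \<le> real (card {y. \<bar>real x - real y\<bar> \<le> sqrt r}) + real (card {y. dst x y \<le> s})" by linarith
  also have "\<dots> \<le> (2 * sqrt r + 1) + 2 * (2 * real s + 1)\<^sup>2"
  proof (intro add_mono card_interval_real)
    have "real (card {y. dst x y \<le> s}) \<le> real (2 * (2 * s + 1)\<^sup>2)"
      using card_ball(2)[of x s] of_nat_mono by blast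
    also have "\<dots> = 2 * (2 * real s + 1)\<^sup>2" by simp
    finally show "real (card {y. dst x y \<le> s}) \<le> 2 * (2 * real s + 1)\<^sup>2" .
  qed (use r in simp)
  also have "\<dots> \<le> (2 * sqrt r + 1) + 2 * (2 * q + 1)\<^sup>2"
    using sq by (intro add_left_mono mult_left_mono power_mono) auto
  also have "\<dots> \<le> (2 * sqrt r + 1) + 2 * (8 * q\<^sup>2 + 2)"
    using zero_le_power2[of "2 * q - 1"]
    by (intro add_left_mono mult_left_mono) (auto simp: power2_eq_square algebra_simps)
  also have "\<dots> \<le> 18 * (sqrt r + 1)" by (simp add: q2)
  finally show "real (card {y. rho_beta x y < r}) \<le> 18 * (sqrt r + 1)" .
qed

lemma V_rho_upper: "0 < r \<Longrightarrow> V_rho UNIV \<mu> \<beta> x r \<le> 144 * (sqrt r + 1)"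
  using card_rho_ball(2)[of r x] by (simp add: V_rho_def smeas_eq)

text \<open>
  The vertices at distance less than \<open>\<surd>r\<close> on the right of \<open>x\<close> suffice; there may be none on the
  left.
\<close>

lemma V_rho_lower:
  assumes r: "0 < r"
  shows "4 * (sqrt r + 1) \<le> V_rho UNIV \<mu> \<beta> x r"
proof -
  define k where "k = nat \<lceil>sqrt r\<rceil>"
  have k: "sqrt r \<le> real k" "1 \<le> k"
  proof -
    show "sqrt r \<le> real k" unfolding k_def by linarith
    moreover have "0 < sqrt r" using r by simp
    ultimately show "1 \<le> k" by linarith
  qed
  have sub: "{x..<x + k} \<subseteq> {y. rho_beta x y < r}"
  proof
    fix y assume y: "y \<in> {x..<x + k}"
    then have "y - x < k" by auto
    then have "real (y - x) < sqrt r" unfolding k_def by linarith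
    then have "(real (y - x))\<^sup>2 < (sqrt r)\<^sup>2" by (intro power_strict_mono) auto
    then have "(real x - real y)\<^sup>2 < r" using y r by (simp add: of_nat_diff power2_commute)
    then show "y \<in> {y. rho_beta x y < r}" using rho_le[of x y] by simp
  qed
  have "k \<le> card {y. rho_beta x y < r}" using card_mono[OF card_rho_ball(1)[OF r] sub] by simp
  then have "real k \<le> real (card {y. rho_beta x y < r})" by simp
  moreover have "1 \<le> real k" using k(2) by simp
  ultimately show ?thesis using k(1) by (simp add: V_rho_def smeas_eq)
qed

lemma D_beta_necklace: "D_beta UNIV \<mu> \<beta>"
  unfolding D_beta_def
proof (intro exI ballI allI impI)
  fix x :: nat and r :: real assume r: "0 < r"
  have "sqrt (2 * r) \<le> sqrt (2\<^sup>2 * r)" using r by (intro real_sqrt_le_mono) simp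
  also have "\<dots> = 2 * sqrt r" by (subst real_sqrt_mult) simp
  finally have "sqrt (2 * r) \<le> 2 * sqrt r" .
  moreover have "0 \<le> sqrt r" using r by simp
  moreover have "V_rho UNIV \<mu> \<beta> x (2 * r) \<le> 144 * (sqrt (2 * r) + 1)"
    using r by (intro V_rho_upper) simp
  ultimately show "V_rho UNIV \<mu> \<beta> x (2 * r) \<le> 72 * V_rho UNIV \<mu> \<beta> x r"
    using V_rho_lower[OF r, of x] unfolding distrib_left by linarith
qed

lemma UE_beta_necklace: "UE_beta UNIV \<mu> \<beta>"
  unfolding UE_beta_def
proof (intro allI exI ballI impI)
  fix N x y k :: nat assume k: "1 \<le> k"
  define c where "c = (2 * real (2 * N + 1)) ^ (2 * N + 1)"
  define d where "d = \<bar>real x - real y\<bar>"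
  let ?V = "V_rho UNIV \<mu> \<beta> x (real k)"
  let ?w = "(1 + rho_beta x y / real k) powr (- real N)"
  have c0: "0 \<le> c" by (simp add: c_def)
  have k0: "1 \<le> sqrt (real k)" "0 < real k" using k by auto
  have V: "0 < ?V" "?V \<le> 288 * sqrt (real k)"
    using V_rho_lower[OF k0(2), of x] V_rho_upper[OF k0(2), of x] k0(1)
    unfolding distrib_left by linarith+
  have "exp (- (d / (2 * sqrt (real k)))) = exp (- (d / sqrt (real k)) / 2)" by simp
  also have "\<dots> \<le> c * (1 + (d / sqrt (real k))\<^sup>2) powr (- real N)"
    unfolding c_def by (rule exp_le_polynomial) (simp add: d_def)
  also have "\<dots> \<le> c * ?w"
  proof (intro mult_left_mono c0 powr_mono2')
    have "rho_beta x y / real k \<le> d\<^sup>2 / real k" using rho_le[of x y] by (simp add: d_def divide_right_mono)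
    then show "1 + rho_beta x y / real k \<le> 1 + (d / sqrt (real k))\<^sup>2" by (simp add: power_divide)
    show "0 < 1 + rho_beta x y / real k" by (simp add: rho_def add_pos_nonneg)
  qed simp
  finally have decay: "exp (- (d / (2 * sqrt (real k)))) \<le> c * ?w" .
  have "p (k - 1) x y \<le> 108 * exp 1 / sqrt (real k) * exp (- (d / (2 * sqrt (real k))))"
    using heat_kernel_bound[of "k - 1" x y] k by (simp add: d_def of_nat_diff)
  also have "\<dots> \<le> 108 * exp 1 / sqrt (real k) * (c * ?w)"
    using decay by (intro mult_left_mono) auto
  also have "\<dots> \<le> (108 * exp 1 * 288 / ?V) * (c * ?w)"
  proof (intro mult_right_mono)
    show "108 * exp 1 / sqrt (real k) \<le> 108 * exp 1 * 288 / ?V"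
      using V k0 by (simp add: field_simps)
    show "0 \<le> c * ?w" using c0 by simp
  qed
  finally show "kernel_iter UNIV \<mu> (k - 1) x y \<le> 3888 * exp 1 * (2 * real (2 * N + 1)) ^ (2 * N + 1) / ?V * ?w"
    unfolding kernel_iter_eq c_def[symmetric] by (simp add: field_simps)
qed

end

section \<open>Failure of volume doubling for the graph distance\<close>

text \<open>
  Dyadic blocks of indices that are fat and thin in turn: \<open>[4\<^bsup>j\<^esup>, 2\<cdot>4\<^bsup>j\<^esup>)\<close> is fat and
  \<open>[2\<cdot>4\<^bsup>j\<^esup>, 4\<^bsup>j+1\<^esup>)\<close> is thin.
\<close>

definition fat :: "nat \<Rightarrow> bool" where
  "fat i \<longleftrightarrow> (\<exists>j. 4 ^ j \<le> i \<and> i < 2 * 4 ^ j)"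

lemma not_fat:
  assumes "2 * 4 ^ j \<le> i" "i < 4 ^ Suc j"
  shows "\<not> fat i"
proof
  assume "fat i"
  then obtain k where k: "4 ^ k \<le> i" "i < 2 * 4 ^ k" by (auto simp: fat_def)
  show False
  proof (cases "k \<le> j")
    case True
    then have "(4::nat) ^ k \<le> 4 ^ j" by (intro power_increasing) auto
    then show False using assms k by linarith
  next
    case False
    then have "(4::nat) ^ Suc j \<le> 4 ^ k" by (intro power_increasing) auto
    then show False using assms k by linarith
  qed
qed

definition beads :: "nat \<Rightarrow> nat" where
  "beads i = (if fat i then i else 1)"

interpretation neck: necklace beads
proof
  show "0 < beads i" for i by (cases "i = 0") (auto simp: beads_def fat_def)
qed

text \<open>
  With \<open>R = 4\<^bsup>j\<^esup>\<close>, the centre is the node in the middle of the thin block \<open>[2R, 4R)\<close>. A ball of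
  radius \<open>R\<close> around it stays in that block, where every cell is a single vertex.
\<close>

lemma thin_ball:
  fixes j :: nat
  defines "R \<equiv> (4::nat) ^ j"
  shows "V_delta UNIV neck.\<mu> (neck.node (3 * R)) (real R) \<le> 16 * real R"
proof -
  let ?B = "{y. real (neck.dst (neck.node (3 * R)) y) < real R}"
  have "?B \<subseteq> neck.node ` {2 * R..<4 * R}"
  proof
    fix y assume "y \<in> ?B"
    then have "\<bar>int (3 * R) - int (neck.cell y)\<bar> < int R"
      using neck.dst_lipschitz(1)[of "neck.node (3 * R)" y] by (simp add: neck.cell_node)
    then have c: "neck.cell y \<in> {2 * R..<4 * R}" by auto
    then have "beads (neck.cell y) = 1"
      using not_fat[of j "neck.cell y"] by (simp add: beads_def R_def)
    then have "y = neck.node (neck.cell y)"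
      using neck.node_cell_le[of y] neck.less_node_Suc_cell[of y] by (simp add: neck.node_Suc)
    then show "y \<in> neck.node ` {2 * R..<4 * R}" using c by blast
  qed
  then have "card ?B \<le> card {2 * R..<4 * R}" by (intro surj_card_le) auto
  then show ?thesis by (simp add: V_delta_def neck.smeas_eq)
qed

text \<open>
  The cells with indices in \<open>[4R, 5R)\<close> have lengths at least \<open>4R\<close>. Their first \<open>R\<close> vertices are
  reached from the same centre along at most \<open>2R\<close> chords and \<open>R\<close> rail edges.
\<close>

lemma fat_ball:
  fixes j :: nat
  defines "R \<equiv> (4::nat) ^ j"
  shows "8 * (real R)\<^sup>2 \<le> V_delta UNIV neck.\<mu> (neck.node (3 * R)) (4 * real R)"
proof -
  let ?B = "{y. real (neck.dst (neck.node (3 * R)) y) < 4 * real R}"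
  define g where "g = (\<lambda>(i, r). neck.node i + r)"
  have cell: "neck.cell (neck.node i + r) = i" if "i \<in> {4 * R..<5 * R}" "r < R" for i r
  proof (rule neck.cell_eqI)
    have "fat i" unfolding fat_def R_def using that by (intro exI[of _ "Suc j"]) (auto simp: R_def)
    then show "neck.node i + r < neck.node (Suc i)" using that by (simp add: neck.node_Suc beads_def)
  qed simp
  have inj: "inj_on g ({4 * R..<5 * R} \<times> {..<R})"
  proof (rule inj_onI)
    fix u v assume uv: "u \<in> {4 * R..<5 * R} \<times> {..<R}" "v \<in> {4 * R..<5 * R} \<times> {..<R}"
      and eq: "g u = g v"
    obtain i r i' r' where *: "u = (i, r)" "v = (i', r')" by (metis surj_pair)
    have "i = i'" using cell[of i r] cell[of i' r'] uv eq by (simp add: g_def *)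
    then show "u = v" using eq by (simp add: g_def *)
  qed
  have sub: "g ` ({4 * R..<5 * R} \<times> {..<R}) \<subseteq> ?B"
  proof (rule image_subsetI)
    fix u assume u: "u \<in> {4 * R..<5 * R} \<times> {..<R}"
    obtain i r where ir: "u = (i, r)" by (metis surj_pair)
    have *: "i \<in> {4 * R..<5 * R}" "r \<in> {..<R}" using u ir by auto
    have "(neck.edge ^^ (i - 3 * R)) (neck.node (3 * R)) (neck.node i)"
      using neck.path_nodes[of "i - 3 * R" "3 * R"] * by simp
    then have "(neck.edge ^^ (i - 3 * R + r)) (neck.node (3 * R)) (neck.node i + r)"
      using neck.path_rail[of r "neck.node i"] unfolding relpowp_add by blast
    then have "neck.dst (neck.node (3 * R)) (neck.node i + r) \<le> i - 3 * R + r" by (rule neck.dst_le)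
    moreover have "4 * R \<le> i" "i < 5 * R" "r < R" using * by auto
    ultimately have "neck.dst (neck.node (3 * R)) (neck.node i + r) < 4 * R" by linarith
    then show "g u \<in> ?B" by (simp add: g_def ir)
  qed
  have "?B \<subseteq> {y. neck.dst (neck.node (3 * R)) y \<le> 4 * R}" by auto
  then have "finite ?B" using neck.card_ball(1) by (rule finite_subset)
  then have "card ({4 * R..<5 * R} \<times> {..<R}) \<le> card ?B" using card_inj_on_le[OF inj sub] by simp
  then have "R\<^sup>2 \<le> card ?B" by (simp add: card_cartesian_product power2_eq_square)
  then have "real (R\<^sup>2) \<le> real (card ?B)" by (rule of_nat_mono)
  then show ?thesis by (simp add: V_delta_def neck.smeas_eq)
qed

text \<open>
  Doubling the radius twice leads from the volume \<open>O(R)\<close> of the thin ball to a volume of order at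
  least \<open>R\<^sup>2\<close>, for every \<open>R = 4\<^bsup>j\<^esup>\<close>.
\<close>

lemma not_D_2: "\<not> D_2 UNIV neck.\<mu>"
proof
  assume "D_2 UNIV neck.\<mu>"
  then obtain C where C:
    "\<And>x (r::nat). V_delta UNIV neck.\<mu> x (2 * real r) \<le> C * V_delta UNIV neck.\<mu> x (real r)"
    unfolding D_2_def by auto
  have small: "4 ^ j \<le> 2 * C\<^sup>2" for j
  proof -
    define R where "R = (4::nat) ^ j"
    define V where "V = V_delta UNIV neck.\<mu> (neck.node (3 * R))"
    have R: "0 < real R" by (simp add: R_def)
    have V0: "0 \<le> V r" for r by (simp add: V_def V_delta_def neck.smeas_eq)
    have "V (2 * real R) \<le> C * V (real R)" using C by (simp add: V_def)
    also have "\<dots> \<le> \<bar>C\<bar> * V (real R)" by (intro mult_right_mono V0) simp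
    finally have 1: "V (2 * real R) \<le> \<bar>C\<bar> * V (real R)" .
    have "V (4 * real R) \<le> C * V (2 * real R)"
      using C[of "neck.node (3 * R)" "2 * R"] by (simp add: V_def)
    also have "\<dots> \<le> \<bar>C\<bar> * V (2 * real R)" by (intro mult_right_mono V0) simp
    also have "\<dots> \<le> \<bar>C\<bar> * (\<bar>C\<bar> * V (real R))" using 1 by (intro mult_left_mono) auto
    also have "\<dots> \<le> \<bar>C\<bar> * (\<bar>C\<bar> * (16 * real R))"
      unfolding V_def R_def by (intro mult_left_mono thin_ball) auto
    finally have "V (4 * real R) \<le> 16 * C\<^sup>2 * real R" by (simp add: power2_eq_square)
    then have "8 * (real R)\<^sup>2 \<le> 16 * C\<^sup>2 * real R"
      using fat_ball[of j] by (simp add: V_def R_def)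
    then have "8 * real R * real R \<le> 16 * C\<^sup>2 * real R" by (simp add: power2_eq_square)
    then have "8 * real R \<le> 16 * C\<^sup>2" using R by (simp only: mult_le_cancel_right_pos)
    then show ?thesis by (simp add: R_def)
  qed
  obtain j where "2 * C\<^sup>2 < 4 ^ j" using real_arch_pow[of 4 "2 * C\<^sup>2"] by auto
  then show False using small[of j] by simp
qed

theorem corollaryA7:
  "\<exists>(\<Gamma> :: nat set) (\<mu> :: nat \<Rightarrow> nat \<Rightarrow> real).
     weighted_graph \<Gamma> \<mu> \<and> connected_graph \<Gamma> \<mu> \<and> LB \<Gamma> \<mu> \<and>
     (\<exists>(\<beta> :: nat \<Rightarrow> nat \<Rightarrow> real) (B :: real).
        (\<forall>x\<in>\<Gamma>. \<forall>y\<in>\<Gamma>. 1 \<le> \<beta> x y \<and> \<beta> x y \<le> B) \<and>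
        D_beta \<Gamma> \<mu> \<beta> \<and> UE_beta \<Gamma> \<mu> \<beta>) \<and>
     (\<forall>m::real. m \<ge> 2 \<longrightarrow> \<not> (D_2 \<Gamma> \<mu> \<and> UE \<Gamma> \<mu> m))"
proof (intro exI conjI ballI allI impI)
  show "\<not> (D_2 UNIV neck.\<mu> \<and> UE UNIV neck.\<mu> m)" for m using not_D_2 by simp
qed (rule neck.weighted_graph_necklace neck.connected_graph_necklace neck.LB_necklace
    neck.\<beta>_bounds neck.D_beta_necklace neck.UE_beta_necklace)+

end
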